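(* Let $l\ge 2$ be an integer, and let $G$ be a connected graph of order $n\geq \kappa_l+l$ with minimum degree $\delta$ and $l$-connectivity $\kappa_l=\kappa_l(G)$. Define the graph $G^{\kappa_l,\delta}_{n}$ as follows. If $\kappa_l>\delta$, $G^{\kappa_l,\delta}_{n}$ is the graph obtained from $K_{1}\cup \big(K_{\kappa_l}\vee (K_{n-\kappa_l-l+1}\cup (l-2)K_1)\big)$ by adding $\delta$ edges between the isolated vertex $K_1$ and vertices of $K_{\kappa_l}$. If $\kappa_l\leq \delta$, $G^{\kappa_l,\delta}_{n}=K_{\kappa_l}\vee\big(K_{n-\kappa_l-(l-1)(\delta-\kappa_l+1)}\cup(l-1)K_{\delta-\kappa_l+1}\big)$. Then $\rho(G)\leq \rho(G^{\kappa_l,\delta}_{n})$, with equality if and only if $G\cong G^{\kappa_l,\delta}_{n}$.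
   Context: All graphs are simple. For an integer $l\ge 2$, the $l$-connectivity $\kappa_l(G)$ of a graph $G$ is the minimum number of vertices of $G$ whose removal produces a disconnected graph with at least $l$ components or a graph with fewer than $l$ vertices. $\rho(G)$ denotes the spectral radius (largest eigenvalue of the adjacency matrix) of $G$. $G_1\vee G_2$ denotes the join of two disjoint graphs (their union together with all edges between them), $G_1\cup G_2$ the disjoint union, and $tK_m$ the disjoint union of $t$ copies of the complete graph $K_m$. *)

theory Defs
  imports
    "Graph_Theory.Graph_Theory"
    "Jordan_Normal_Form.Spectral_Radius"
    "HOL-Library.Countable_Set"
begin

text \<open>
  A simple graph is a \<^const>\<open>pair_graph\<close>: a finite, loop-free digraph whose arc relation is
  symmetric, each undirected edge being represented by its two arcs. Out-degree, strong
  components and isomorphism of digraphs are then degree, connected components and isomorphism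
  of graphs.
\<close>

definition min_degree :: "'a pair_pre_digraph \<Rightarrow> nat" where
  "min_degree G = Min (out_degree (with_proj G) ` pverts G)"

definition num_components :: "('a, 'b) pre_digraph \<Rightarrow> nat" where
  "num_components G = card (pre_digraph.sccs G)"

definition l_connectivity :: "nat \<Rightarrow> 'a pair_pre_digraph \<Rightarrow> nat" where
  "l_connectivity l G = (LEAST k. \<exists>S \<subseteq> pverts G. card S = k \<and>
     (let H = induce_subgraph (with_proj G) (pverts G - S) in
        (\<not> Digraph_Component.connected H \<and> num_components H \<ge> l) \<or> card (verts H) < l))"

text \<open>
  The vertices are enumerated by \<^const>\<open>from_nat_into\<close>, a bijection from the numbers below
  \<open>card V\<close> to a finite set \<open>V\<close>; the spectrum does not depend on the enumeration.
\<close>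

definition adjacency_matrix :: "'a pair_pre_digraph \<Rightarrow> real mat" where
  "adjacency_matrix G =
     (let n = card (pverts G); v = from_nat_into (pverts G)
      in mat n n (\<lambda>(i, j). if (v i, v j) \<in> parcs G then 1 else 0))"

definition graph_spectral_radius :: "'a pair_pre_digraph \<Rightarrow> real" where
  "graph_spectral_radius G = Max (spectrum (adjacency_matrix G))"

text \<open>The next two operations are meant for graphs with disjoint vertex sets.\<close>

definition graph_union :: "'a pair_pre_digraph \<Rightarrow> 'a pair_pre_digraph \<Rightarrow> 'a pair_pre_digraph" where
  "graph_union G H = \<lparr> pverts = pverts G \<union> pverts H, parcs = parcs G \<union> parcs H \<rparr>"

definition graph_join :: "'a pair_pre_digraph \<Rightarrow> 'a pair_pre_digraph \<Rightarrow> 'a pair_pre_digraph" where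
  "graph_join G H = \<lparr> pverts = pverts G \<union> pverts H,
     parcs = parcs G \<union> parcs H \<union> pverts G \<times> pverts H \<union> pverts H \<times> pverts G \<rparr>"

definition add_edges :: "'a pair_pre_digraph \<Rightarrow> ('a \<times> 'a) set \<Rightarrow> 'a pair_pre_digraph" where
  "add_edges G F = \<lparr> pverts = pverts G, parcs = parcs G \<union> F \<union> F\<inverse> \<rparr>"

text \<open>
  Disjoint copies of \<open>K\<^sub>m\<close>, one for each label \<open>t \<in> T\<close>, with vertices \<open>(t, 0), \<dots>, (t, m - 1)\<close>.
  Distinct labels keep the parts of the graphs below disjoint.
\<close>

definition complete_copies :: "nat set \<Rightarrow> nat \<Rightarrow> (nat \<times> nat) pair_pre_digraph" where
  "complete_copies T m = \<lparr> pverts = T \<times> {..<m},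
     parcs = {((t, i), (t, j)) | t i j. t \<in> T \<and> i < m \<and> j < m \<and> i \<noteq> j} \<rparr>"

abbreviation complete_graph :: "nat \<Rightarrow> nat \<Rightarrow> (nat \<times> nat) pair_pre_digraph" where
  "complete_graph t m \<equiv> complete_copies {t} m"

text \<open>
  In the first case the isolated vertex is \<open>(l, 0)\<close>, and it is joined to \<open>\<delta>\<close> of the \<open>\<kappa>\<close> vertices
  of the complete graph labelled 0; up to isomorphism their choice is immaterial. The label
  sets \<open>{2..<l}\<close> and \<open>{2..l}\<close> have \<open>l - 2\<close> and \<open>l - 1\<close> elements. The truncated subtractions are
  exact for the parameters of a connected graph of order \<open>n \<ge> \<kappa> + l\<close>: in the second case,
  removing \<open>\<kappa>\<close> vertices leaves at least \<open>l\<close> components, each with at least \<open>\<delta> - \<kappa> + 1\<close> vertices.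
\<close>

definition extremal_graph :: "nat \<Rightarrow> nat \<Rightarrow> nat \<Rightarrow> nat \<Rightarrow> (nat \<times> nat) pair_pre_digraph" where
  "extremal_graph l n \<kappa> \<delta> =
     (if \<kappa> > \<delta> then
        add_edges
          (graph_union (complete_graph l 1)
             (graph_join (complete_graph 0 \<kappa>)
                (graph_union (complete_graph 1 (n - \<kappa> - l + 1)) (complete_copies {2..<l} 1))))
          {((l, 0), (0, i)) | i. i < \<delta>}
      else
        graph_join (complete_graph 0 \<kappa>)
          (graph_union (complete_graph 1 (n - \<kappa> - (l - 1) * (\<delta> - \<kappa> + 1)))
             (complete_copies {2..l} (\<delta> - \<kappa> + 1))))"

end

theory Submission
  imports Defs "HOL-Analysis.Function_Topology"
begin

text \<open>
  Let \<open>x\<close> be the positive Perron vector of \<open>G\<close>, of spectral radius \<open>\<rho>\<close>. On the vertex set of \<open>G\<close> we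
  build a copy \<open>H\<close> of the extremal graph whose quadratic form is at least that of \<open>G\<close> at \<open>x\<close>; then
  \<open>\<rho> \<le> \<rho>(H)\<close> by the Rayleigh principle. If equality holds, \<open>x\<close> is also an eigenvector of \<open>H\<close> for \<open>\<rho>\<close>,
  so at each vertex the two neighbourhoods have the same \<open>x\<close>-mass; wherever one is contained in the
  other they coincide, and these inclusions propagate through the graph until \<open>G = H\<close>.

  To construct \<open>H\<close>, remove a cut \<open>S\<close> of \<open>\<kappa>\<close> vertices leaving at least \<open>l\<close> components. If
  \<open>\<kappa> \<le> \<delta>\<close>, every component has at least \<open>\<delta> - \<kappa> + 1\<close> vertices; keep a set of exactly this
  size from each of \<open>l - 1\<close> components and merge everything else with the component of largest
  \<open>x\<close>-mass. If \<open>\<kappa> > \<delta>\<close>, a vertex \<open>v\<close> of degree \<open>\<delta>\<close> is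
  set aside: without \<open>v\<close> there is still a set of \<open>\<kappa>\<close> vertices whose removal leaves at least \<open>l - 1\<close>
  components, which are regrouped in the same way into single vertices and one clique, and finally
  the neighbours of \<open>v\<close> are moved into the join set.
\<close>


section \<open>Rayleigh principle and Perron vectors\<close>

definition nbr_sum :: "('a \<Rightarrow> real) \<Rightarrow> 'a rel \<Rightarrow> 'a \<Rightarrow> real" where
  "nbr_sum x E a = (\<Sum>b\<in>E `` {a}. x b)"

definition quad_form :: "('a \<Rightarrow> real) \<Rightarrow> 'a rel \<Rightarrow> real" where
  "quad_form x E = (\<Sum>(a, b)\<in>E. x a * x b)"

text \<open>Eigenvectors are functions on the vertices, so that no enumeration enters;
  \<open>spectrum_adjacency_matrix\<close> gives the link to matrices.\<close>

definition eigenvalue_on :: "'a set \<Rightarrow> 'a rel \<Rightarrow> real \<Rightarrow> bool" where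
  "eigenvalue_on V E k \<longleftrightarrow> (\<exists>x. (\<exists>a\<in>V. x a \<noteq> 0) \<and> (\<forall>a\<in>V. nbr_sum x E a = k * x a))"

lemma finite_rel_on: "finite V \<Longrightarrow> E \<subseteq> V \<times> V \<Longrightarrow> finite E"
  by (meson finite_SigmaI finite_subset)

lemma quad_form_eq_nbr_sum:
  assumes "finite V" "E \<subseteq> V \<times> V"
  shows "quad_form x E = (\<Sum>a\<in>V. x a * nbr_sum x E a)"
proof -
  have "E = Sigma V (\<lambda>a. E `` {a})"
    using assms(2) by auto
  moreover have "\<forall>a\<in>V. finite (E `` {a})"
    using finite_rel_on[OF assms] by (auto intro: finite_subset[of _ "snd ` E"] simp: image_iff)
  ultimately show ?thesis
    unfolding quad_form_def nbr_sum_def sum_distrib_left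
    by (metis (no_types, lifting) assms(1) sum.Sigma sum.cong)
qed

lemma quad_form_mono:
  assumes "finite E'" "E \<subseteq> E'" "\<And>a. x a \<ge> 0"
  shows "quad_form x E \<le> quad_form x E'"
  unfolding quad_form_def by (rule sum_mono2) (use assms in auto)

text \<open>The two cross terms agree because \<open>E\<close> is symmetric. This is the expansion
  needed to vary a maximizer in one coordinate.\<close>

lemma quad_form_add_delta:
  assumes "finite V" "E \<subseteq> V \<times> V" "sym E" "a \<in> V"
  shows "quad_form (\<lambda>b. x b + (if b = a then t else 0)) E =
    quad_form x E + 2 * t * nbr_sum x E a + (if (a, a) \<in> E then t\<^sup>2 else 0)"
proof -
  let ?d = "\<lambda>b. if b = a then t else 0"
  have fE: "finite E" using assms finite_rel_on by blast
  have 1: "(\<Sum>(b, c)\<in>E. ?d b * x c) = t * nbr_sum x E a"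
  proof -
    have "(\<Sum>(b, c)\<in>E. ?d b * x c) = (\<Sum>p\<in>{a} \<times> (E `` {a}). (case p of (b, c) \<Rightarrow> t * x c))"
      by (rule sum.mono_neutral_cong_right[OF fE]) (auto split: if_splits)
    also have "\<dots> = t * nbr_sum x E a"
      by (simp add: nbr_sum_def sum_distrib_left sum.cartesian_product[symmetric])
    finally show ?thesis .
  qed
  have 2: "(\<Sum>(b, c)\<in>E. x b * ?d c) = (\<Sum>(b, c)\<in>E. ?d b * x c)"
    by (rule sum.reindex_bij_witness[where i=prod.swap and j=prod.swap])
      (use \<open>sym E\<close> in \<open>auto dest: symD\<close>)
  have 3: "(\<Sum>(b, c)\<in>E. ?d b * ?d c) = (if (a, a) \<in> E then t\<^sup>2 else 0)"
  proof -
    have "(\<Sum>(b, c)\<in>E. ?d b * ?d c) = (\<Sum>p\<in>E. if p = (a, a) then t\<^sup>2 else 0)"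
      by (rule sum.cong) (auto simp: power2_eq_square split: if_splits)
    then show ?thesis using fE by simp
  qed
  have "quad_form (\<lambda>b. x b + ?d b) E =
     (\<Sum>(b, c)\<in>E. x b * x c) + (\<Sum>(b, c)\<in>E. ?d b * x c) + (\<Sum>(b, c)\<in>E. x b * ?d c)
     + (\<Sum>(b, c)\<in>E. ?d b * ?d c)"
    unfolding quad_form_def sum.distrib[symmetric]
    by (rule sum.cong) (auto simp: algebra_simps)
  then show ?thesis
    using 1 2 3 by (simp add: quad_form_def)
qed

text \<open>First variation in one coordinate: with \<open>d\<close> the defect of the eigenvalue
  equation at \<open>a\<close>, changing \<open>x a\<close> by \<open>t\<close> would gain about
  \<open>2 * t * d\<close> at a cost only quadratic in \<open>t\<close>.\<close>

lemma rayleigh_maximizer_eigenvector: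
  assumes "finite V" "E \<subseteq> V \<times> V" "sym E"
    and bound: "\<And>y. quad_form y E \<le> \<mu> * (\<Sum>a\<in>V. (y a)\<^sup>2)"
    and eq: "quad_form x E = \<mu> * (\<Sum>a\<in>V. (x a)\<^sup>2)"
    and "a \<in> V"
  shows "nbr_sum x E a = \<mu> * x a"
proof (rule ccontr)
  define d where "d = nbr_sum x E a - \<mu> * x a"
  assume "nbr_sum x E a \<noteq> \<mu> * x a"
  then have d: "d \<noteq> 0" by (simp add: d_def)
  define K where "K = \<bar>\<mu>\<bar> + 1"
  have "K > 0" by (simp add: K_def)
  have key: "2 * t * d \<le> t\<^sup>2 * \<bar>\<mu>\<bar>" for t
  proof -
    let ?y = "\<lambda>b. x b + (if b = a then t else 0)"
    have "(\<Sum>b\<in>V. (?y b)\<^sup>2) = (\<Sum>b\<in>V. (x b)\<^sup>2 + (if b = a then 2 * t * x a + t\<^sup>2 else 0))"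
      by (rule sum.cong) (auto simp: power2_sum)
    also have "\<dots> = (\<Sum>b\<in>V. (x b)\<^sup>2) + (2 * t * x a + t\<^sup>2)"
      using assms by (simp add: sum.distrib)
    finally have "2 * t * nbr_sum x E a + (if (a, a) \<in> E then t\<^sup>2 else 0)
        \<le> \<mu> * (2 * t * x a + t\<^sup>2)"
      using bound[of ?y] eq quad_form_add_delta[OF assms(1-3) \<open>a \<in> V\<close>, of x t]
      by (simp add: algebra_simps)
    \<comment> \<open>The loop term is nonnegative and may be dropped.\<close>
    then have "2 * t * d \<le> t\<^sup>2 * \<mu>"
      by (auto simp: d_def algebra_simps split: if_splits) (smt (verit) zero_le_power2)
    also have "\<dots> \<le> t\<^sup>2 * \<bar>\<mu>\<bar>" by (simp add: mult_left_mono)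
    finally show ?thesis .
  qed
  \<comment> \<open>This \<open>t\<close> is small enough for the linear term to win; the summand 1
    in \<open>K\<close> excludes division by zero.\<close>
  have "2 * (d / K) * d \<le> (d / K)\<^sup>2 * \<bar>\<mu>\<bar>" by (rule key)
  also have "\<dots> \<le> (d / K)\<^sup>2 * K" by (rule mult_left_mono) (auto simp: K_def)
  finally have "2 * d\<^sup>2 \<le> d\<^sup>2"
    using \<open>K > 0\<close> by (simp add: field_simps power2_eq_square)
  then show False using d by simp
qed

lemma quad_form_scale: "quad_form (\<lambda>a. c * x a) E = c\<^sup>2 * quad_form x E"
  by (simp add: quad_form_def sum_distrib_left power2_eq_square case_prod_beta mult_ac)

lemma quad_form_le_abs: "quad_form x E \<le> quad_form (\<lambda>a. \<bar>x a\<bar>) E"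
  unfolding quad_form_def by (rule sum_mono) (auto simp flip: abs_mult)

text \<open>A maximum on the unit sphere exists by compactness, absolute values make the maximizer
  nonnegative, and homogeneity carries the bound from the sphere to all functions.\<close>

lemma quad_form_maximum:
  assumes "finite V" "V \<noteq> {}" "E \<subseteq> V \<times> V"
  obtains x \<mu> where "\<And>a. x a \<ge> 0" "(\<Sum>a\<in>V. (x a)\<^sup>2) = 1" "quad_form x E = \<mu>"
    "\<And>y. quad_form y E \<le> \<mu> * (\<Sum>a\<in>V. (y a)\<^sup>2)"
proof -
  \<comment> \<open>Functions on the whole type are confined to 0 outside \<open>V\<close>, so this
    box is compact by Tychonoff even over an infinite vertex type.\<close>
  define B :: "('a \<Rightarrow> real) set" where "B = PiE UNIV (\<lambda>a. if a \<in> V then {-1..1} else {0})"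
  define K where "K = B \<inter> {x. (\<Sum>a\<in>V. (x a)\<^sup>2) = 1}"
  have fE: "finite E" using assms finite_rel_on by blast
  have "compactin (product_topology (\<lambda>_. euclidean) UNIV) B"
    unfolding B_def compactin_PiE by auto
  then have "compact B" by (simp add: euclidean_product_topology)
  moreover have "closed {x :: 'a \<Rightarrow> real. (\<Sum>a\<in>V. (x a)\<^sup>2) = 1}"
    by (intro closed_Collect_eq continuous_intros continuous_on_product_coordinates)
  ultimately have "compact K" unfolding K_def by blast
  moreover obtain a where "a \<in> V" using assms by blast
  then have "(\<lambda>b. if b = a then 1 else 0) \<in> K"
    using assms(1) by (auto simp: K_def B_def if_distrib[where f="\<lambda>z. z\<^sup>2"] cong: if_cong)
  then have "K \<noteq> {}" by blast
  moreover have "continuous_on K (\<lambda>x. quad_form x E)"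
    unfolding quad_form_def case_prod_beta
    by (intro continuous_intros continuous_on_subset[OF continuous_on_product_coordinates]) auto
  ultimately obtain x where x: "x \<in> K" and max: "\<And>y. y \<in> K \<Longrightarrow> quad_form y E \<le> quad_form x E"
    using continuous_attains_sup[of K "\<lambda>x. quad_form x E"] by blast
  define z where "z a = \<bar>x a\<bar>" for a
  have z1: "(\<Sum>a\<in>V. (z a)\<^sup>2) = 1" using x by (simp add: z_def K_def)
  have "z \<in> K" using x z1 by (fastforce simp: z_def K_def B_def PiE_iff abs_le_iff split: if_splits)
  then have "quad_form z E = quad_form x E"
    using max[of z] quad_form_le_abs[of x E] by (simp add: z_def[abs_def])
  have bound: "quad_form y E \<le> quad_form z E * (\<Sum>a\<in>V. (y a)\<^sup>2)" for y
  proof (cases "(\<Sum>a\<in>V. (y a)\<^sup>2) = 0")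
    case True
    then have "\<forall>a\<in>V. y a = 0" using assms(1) by (simp add: sum_nonneg_eq_0_iff)
    then have "quad_form y E = 0" 
      using assms(3) unfolding quad_form_def by (intro sum.neutral) auto
    then show ?thesis using True by simp
  next
    case False
    define s where "s = (\<Sum>a\<in>V. (y a)\<^sup>2)"
    have "s > 0" using False by (simp add: s_def sum_nonneg order_less_le)
    \<comment> \<open>Normalizing \<open>y\<close> and cutting it off outside \<open>V\<close> gives
      a point of \<open>K\<close>; the form only sees values on \<open>V\<close>.\<close>
    define w where "w a = (if a \<in> V then 1 / sqrt s * y a else 0)" for a
    have "(\<Sum>a\<in>V. (w a)\<^sup>2) = (\<Sum>a\<in>V. (y a)\<^sup>2 / s)"
      using \<open>s > 0\<close> by (intro sum.cong) (auto simp: w_def power_divide)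
    also have "\<dots> = 1" using \<open>s > 0\<close> by (simp add: s_def flip: sum_divide_distrib)
    finally have w1: "(\<Sum>a\<in>V. (w a)\<^sup>2) = 1" .
    have "(w a)\<^sup>2 \<le> 1" if "a \<in> V" for a
      using w1 member_le_sum[of a V "\<lambda>a. (w a)\<^sup>2"] that assms(1) by simp
    then have "\<bar>w a\<bar> \<le> 1" if "a \<in> V" for a
      using that abs_square_le_1 by blast
    then have "w a \<in> (if a \<in> V then {-1..1} else {0})" for a
      by (simp add: abs_le_iff minus_le_iff) (simp add: w_def)
    then have "w \<in> K" using w1 by (simp add: K_def B_def PiE_iff)
    then have "quad_form w E \<le> quad_form z E"
      using max \<open>quad_form z E = quad_form x E\<close> by simp
    moreover have "quad_form w E = quad_form (\<lambda>a. 1 / sqrt s * y a) E"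
      unfolding quad_form_def using assms(3) by (intro sum.cong) (auto simp: w_def)
    ultimately show ?thesis
      using \<open>s > 0\<close> unfolding quad_form_scale s_def[symmetric]
      by (simp add: power_divide field_simps)
  qed
  show ?thesis using that[of z, OF _ z1 refl bound] by (simp add: z_def)
qed

text \<open>The enumeration \<open>v\<close> is a bijection, so vectors and functions on
  \<open>V\<close> correspond, and multiplication by the matrix becomes
  \<open>nbr_sum\<close>.\<close>

lemma spectrum_adjacency_matrix:
  assumes "finite (pverts G)" "parcs G \<subseteq> pverts G \<times> pverts G"
  shows "spectrum (adjacency_matrix G) = {k. eigenvalue_on (pverts G) (parcs G) k}"
proof -
  define V E n v A where "V = pverts G" and "E = parcs G" and "n = card V"
    and "v = from_nat_into V" and "A = adjacency_matrix G"
  have fV: "finite V" and EV: "E \<subseteq> V \<times> V" using assms by (auto simp: V_def E_def)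
  have bij: "bij_betw v {..<n} V"
    unfolding v_def n_def using bij_betw_from_nat_into_finite[OF fV] .
  have dim: "dim_row A = n" "dim_col A = n"
    by (auto simp: A_def adjacency_matrix_def Let_def n_def V_def)
  have A: "A $$ (i, j) = (if (v i, v j) \<in> E then 1 else 0)" if "i < n" "j < n" for i j
    using that by (auto simp: A_def adjacency_matrix_def Let_def n_def V_def v_def E_def)
  have mult: "(A *\<^sub>v w) $ i = nbr_sum x E (v i)"
    if w: "w \<in> carrier_vec n" and x: "\<And>j. j < n \<Longrightarrow> w $ j = x (v j)" and "i < n" for w x i
  proof -
    have "(A *\<^sub>v w) $ i = (\<Sum>j = 0..<n. A $$ (i, j) * w $ j)"
      using w dim \<open>i < n\<close> by (simp add: scalar_prod_def)
    also have "\<dots> = (\<Sum>j<n. (if (v i, v j) \<in> E then x (v j) else 0))"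
      using \<open>i < n\<close> x by (intro sum.cong) (auto simp: A)
    also have "\<dots> = (\<Sum>b\<in>V. (if (v i, b) \<in> E then x b else 0))"
      by (rule sum.reindex_bij_betw[OF bij])
    also have "\<dots> = nbr_sum x E (v i)"
      unfolding nbr_sum_def using fV EV
      by (intro sum.mono_neutral_cong_right) auto
    finally show ?thesis .
  qed
  have "eigenvalue A k \<longleftrightarrow> eigenvalue_on V E k" for k
  proof
    assume "eigenvalue A k"
    then obtain w where w: "w \<in> carrier_vec n" "w \<noteq> 0\<^sub>v n" "A *\<^sub>v w = k \<cdot>\<^sub>v w"
      unfolding eigenvalue_def eigenvector_def dim by blast
    define x where "x a = w $ the_inv_into {..<n} v a" for a
    have xw: "w $ j = x (v j)" if "j < n" for j
      using that bij by (simp add: x_def the_inv_into_f_f bij_betw_def)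
    have "nbr_sum x E (v i) = k * x (v i)" if "i < n" for i
      using mult[OF w(1) xw that] w that xw by simp
    moreover obtain j where "j < n" "w $ j \<noteq> 0"
      using w(1,2) by (metis carrier_vecD eq_vecI index_zero_vec)
    moreover have "V = v ` {..<n}" using bij by (simp add: bij_betw_def)
    ultimately show "eigenvalue_on V E k"
      unfolding eigenvalue_on_def using xw by (intro exI[of _ x]) auto
  next
    assume "eigenvalue_on V E k"
    then obtain x where x: "\<exists>a\<in>V. x a \<noteq> 0" "\<forall>a\<in>V. nbr_sum x E a = k * x a"
      unfolding eigenvalue_on_def by blast
    define w where "w = vec n (\<lambda>i. x (v i))"
    have w: "w \<in> carrier_vec n" by (simp add: w_def)
    have xw: "w $ j = x (v j)" if "j < n" for j using that by (simp add: w_def)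
    have vV: "v i \<in> V" if "i < n" for i using that bij by (auto simp: bij_betw_def)
    have "A *\<^sub>v w = k \<cdot>\<^sub>v w"
    proof (rule eq_vecI)
      fix i assume "i < dim_vec (k \<cdot>\<^sub>v w)"
      then have "i < n" by (simp add: w_def)
      then show "(A *\<^sub>v w) $ i = (k \<cdot>\<^sub>v w) $ i"
        using mult[OF w xw \<open>i < n\<close>] x(2) vV xw w by simp
    qed (use w dim in auto)
    moreover have "w \<noteq> 0\<^sub>v n"
    proof -
      obtain j where "j < n" "x (v j) \<noteq> 0"
        using x(1) bij by (auto simp: bij_betw_def)
      then show ?thesis using xw by fastforce
    qed
    ultimately show "eigenvalue A k"
      unfolding eigenvalue_def eigenvector_def dim using w by blast
  qed
  then show ?thesis by (auto simp: spectrum_def A_def V_def E_def)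
qed

text \<open>The maximum \<mu> of the Rayleigh quotient is an eigenvalue, attained at its maximizer,
  and every eigenvalue is the quotient of its own eigenvector, hence at most \<mu>. So \<mu> is the
  largest element of the spectrum.\<close>

lemma graph_spectral_radius_rayleigh:
  assumes "finite (pverts G)" "pverts G \<noteq> {}" "parcs G \<subseteq> pverts G \<times> pverts G" "sym (parcs G)"
  shows graph_spectral_radius_upper:
      "quad_form y (parcs G) \<le> graph_spectral_radius G * (\<Sum>a\<in>pverts G. (y a)\<^sup>2)"
    and graph_spectral_radius_attained:
      "\<exists>x. (\<forall>a. x a \<ge> 0) \<and> (\<Sum>a\<in>pverts G. (x a)\<^sup>2) = 1 \<and>
         quad_form x (parcs G) = graph_spectral_radius G"
proof -
  let ?V = "pverts G" and ?E = "parcs G"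
  obtain x \<mu> where x: "\<And>a. x a \<ge> 0" "(\<Sum>a\<in>?V. (x a)\<^sup>2) = 1" "quad_form x ?E = \<mu>"
    and bound: "\<And>y. quad_form y ?E \<le> \<mu> * (\<Sum>a\<in>?V. (y a)\<^sup>2)"
    by (rule quad_form_maximum[OF assms(1-3)]) (rule that, assumption+)
  let ?S = "spectrum (adjacency_matrix G)"
  have S: "?S = {k. eigenvalue_on ?V ?E k}"
    using spectrum_adjacency_matrix assms by blast
  have "adjacency_matrix G \<in> carrier_mat (card ?V) (card ?V)"
    by (simp add: adjacency_matrix_def Let_def)
  then have "finite ?S" using card_finite_spectrum by blast
  moreover have "\<mu> \<in> ?S"
  proof -
    have "nbr_sum x ?E a = \<mu> * x a" if "a \<in> ?V" for a
      by (rule rayleigh_maximizer_eigenvector[OF assms(1,3,4) bound _ that]) (simp add: x)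
    moreover have "\<exists>a\<in>?V. x a \<noteq> 0" using x(2) by (metis power_zero_numeral sum.neutral zero_neq_one)
    ultimately show ?thesis unfolding S eigenvalue_on_def by blast
  qed
  moreover have "k \<le> \<mu>" if k: "k \<in> ?S" for k
  proof -
    obtain y where y: "\<exists>a\<in>?V. y a \<noteq> 0" "\<forall>a\<in>?V. nbr_sum y ?E a = k * y a"
      using k unfolding S eigenvalue_on_def by blast
    have "quad_form y ?E = k * (\<Sum>a\<in>?V. (y a)\<^sup>2)"
      unfolding quad_form_eq_nbr_sum[OF assms(1,3)] sum_distrib_left
      using y(2) by (intro sum.cong) (auto simp: power2_eq_square)
    moreover have "(\<Sum>a\<in>?V. (y a)\<^sup>2) > 0"
      using y(1) assms(1) by (metis sum_pos2 zero_le_power2 zero_less_power2)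
    ultimately show ?thesis using bound[of y] by simp
  qed
  ultimately have "graph_spectral_radius G = \<mu>"
    unfolding graph_spectral_radius_def by (intro Max_eqI) auto
  then show "quad_form y ?E \<le> graph_spectral_radius G * (\<Sum>a\<in>?V. (y a)\<^sup>2)"
    and "\<exists>x. (\<forall>a. x a \<ge> 0) \<and> (\<Sum>a\<in>?V. (x a)\<^sup>2) = 1 \<and> quad_form x ?E = graph_spectral_radius G"
    using bound x by blast+
qed

text \<open>A test vector bounds the spectral radius from below; if the bound is attained, the test
  vector is a maximizer and therefore an eigenvector.\<close>

lemma graph_spectral_radius_compare:
  assumes "finite (pverts H)" "parcs H \<subseteq> pverts H \<times> pverts H" "sym (parcs H)"
    and "\<exists>a\<in>pverts H. x a \<noteq> 0"
    and "r * (\<Sum>a\<in>pverts H. (x a)\<^sup>2) \<le> quad_form x (parcs H)"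
  shows "r \<le> graph_spectral_radius H"
    and "r = graph_spectral_radius H \<Longrightarrow> a \<in> pverts H \<Longrightarrow> nbr_sum x (parcs H) a = r * x a"
proof -
  have "pverts H \<noteq> {}" using assms(4) by blast
  note up = graph_spectral_radius_upper[OF assms(1) this assms(2,3)]
  have "(\<Sum>a\<in>pverts H. (x a)\<^sup>2) > 0"
    using assms(1,4) by (metis sum_pos2 zero_le_power2 zero_less_power2)
  then show "r \<le> graph_spectral_radius H"
    using up[of x] assms(5) by (meson mult_le_cancel_right_pos order_trans)
  show "nbr_sum x (parcs H) a = r * x a" if "r = graph_spectral_radius H" "a \<in> pverts H"
    using rayleigh_maximizer_eigenvector[OF assms(1-3) up] up[of x] assms(5) that by force
qed

text \<open>With positive weights a proper inclusion of neighbourhoods would make the sums differ.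
  All rigidity arguments below rest on this.\<close>

lemma nbrs_eq_of_nbr_sum_eq:
  assumes "finite E'" "E `` {a} \<subseteq> E' `` {a}" "\<And>b. b \<in> E' `` {a} \<Longrightarrow> x b > 0"
    and "nbr_sum x E a = nbr_sum x E' a"
  shows "E `` {a} = E' `` {a}"
proof (rule ccontr)
  assume "E `` {a} \<noteq> E' `` {a}"
  then obtain b where b: "b \<in> E' `` {a} - E `` {a}" using assms(2) by blast
  have "finite (E' `` {a})" using assms(1) by (rule finite_Image)
  then have "sum x (E `` {a}) < sum x (E' `` {a})"
    by (rule sum_strict_mono2) (use assms b in \<open>auto intro: less_imp_le\<close>)
  then show False using assms(4) by (simp add: nbr_sum_def)
qed

text \<open>A nonnegative maximizer is an eigenvector. If it vanished at one vertex, the neighbour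
  sum there would be 0, so it would vanish at all neighbours and, by connectivity,
  everywhere.\<close>

lemma perron_vector:
  fixes G :: "'a pair_pre_digraph"
  assumes "pair_graph G" "Digraph_Component.connected (with_proj G)"
  obtains x where "\<And>a. a \<in> pverts G \<Longrightarrow> x a > 0" "\<And>a. x a \<ge> 0"
    "quad_form x (parcs G) = graph_spectral_radius G * (\<Sum>a\<in>pverts G. (x a)\<^sup>2)"
    "\<And>a. a \<in> pverts G \<Longrightarrow> nbr_sum x (parcs G) a = graph_spectral_radius G * x a"
proof -
  interpret pair_graph G by fact
  let ?V = "pverts G" and ?E = "parcs G"
  have fV: "finite ?V" by (rule pair_finite_verts)
  have EV: "?E \<subseteq> ?V \<times> ?V" using arc_fst_in_verts arc_snd_in_verts by fastforce
  have symE: "sym ?E" using pair_sym_arcs by (simp add: symmetric_def)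
  have ne: "?V \<noteq> {}"
    using assms(2) by (auto simp: connected_def strongly_connected_def mk_symmetric_def)
  obtain x where x: "\<And>a. x a \<ge> 0" "(\<Sum>a\<in>?V. (x a)\<^sup>2) = 1"
    "quad_form x ?E = graph_spectral_radius G"
    using graph_spectral_radius_attained[OF fV ne EV symE] by blast
  have ev: "nbr_sum x ?E a = graph_spectral_radius G * x a" if "a \<in> ?V" for a
    using rayleigh_maximizer_eigenvector[OF fV EV symE
      graph_spectral_radius_upper[OF fV ne EV symE] _ that, of x] x by simp
  have spread: "x b = 0" if "x a = 0" "(a, b) \<in> ?E" for a b
  proof -
    have "nbr_sum x ?E a = 0" using ev[of a] that EV by auto
    moreover have "finite (?E `` {a})" by (simp add: finite_Image finite_rel_on[OF fV EV])
    ultimately show ?thesis using that x(1) by (auto simp: nbr_sum_def sum_nonneg_eq_0_iff)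
  qed
  have "x a > 0" if a: "a \<in> ?V" for a
  proof (rule ccontr)
    assume "\<not> x a > 0"
    then have "x a = 0" using x(1)[of a] by simp
    have "x b = 0" if "b \<in> ?V" for b
    proof -
      have "a \<rightarrow>\<^sup>*\<^bsub>with_proj (mk_symmetric G)\<^esub> b"
        using assms(2) a that by (auto simp: connected_def strongly_connected_def mk_symmetric_def)
      \<comment> \<open>Connectivity is defined through the symmetric closure, which adds nothing to
        symmetric arcs.\<close>
      moreover have "mk_symmetric G = G"
      proof -
        have "parcs (mk_symmetric (with_proj G)) = parcs G"
          using symE by (auto simp: mk_symmetric_def dest: symD)
        then show ?thesis by (simp add: mk_symmetric_def)
      qed
      ultimately have "(a, b) \<in> ?E\<^sup>*"
        using reachable_rtranclI[of "with_proj G" a b] by simp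
      then show ?thesis
        by (induction rule: rtrancl_induct) (use \<open>x a = 0\<close> spread in auto)
    qed
    then show False using x(2) by simp
  qed
  then show ?thesis using that[of x] x ev by simp
qed


section \<open>Isomorphisms and coloured graphs\<close>

lemma digraph_iso_with_projI:
  assumes "bij_betw f (pverts G) (pverts H)"
    and "parcs G \<subseteq> pverts G \<times> pverts G" "parcs H \<subseteq> pverts H \<times> pverts H"
    and arcs: "\<And>a b. a \<in> pverts G \<Longrightarrow> b \<in> pverts G \<Longrightarrow> (a, b) \<in> parcs G \<longleftrightarrow> (f a, f b) \<in> parcs H"
  shows "digraph_iso (with_proj G) (with_proj H)"
proof -
  let ?h = "\<lparr> iso_verts = f, iso_arcs = map_prod f f, iso_head = snd, iso_tail = fst \<rparr>"
  have inj: "inj_on f (pverts G)" and im: "f ` pverts G = pverts H"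
    using assms(1) by (auto simp: bij_betw_def)
  have "pair_wf_digraph G"
    using assms(2) by unfold_locales auto
  then have "wf_digraph (with_proj G)"
    by (simp add: wf_digraph_wp_iff)
  moreover have "inj_on (map_prod f f) (parcs G)"
    using map_prod_inj_on[OF inj inj] assms(2) by (rule inj_on_subset)
  ultimately have "pre_digraph.digraph_isomorphism (with_proj G) ?h"
    using inj by (simp add: pre_digraph.digraph_isomorphism_def)
  moreover have "parcs H = map_prod f f ` parcs G"
  proof (intro equalityI subsetI)
    fix p assume p: "p \<in> parcs H"
    then have "p \<in> (f ` pverts G) \<times> (f ` pverts G)" using assms(3) im by blast
    then obtain a b where ab: "p = (f a, f b)" "a \<in> pverts G" "b \<in> pverts G" by blast
    then have "(a, b) \<in> parcs G" using arcs p by simp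
    then show "p \<in> map_prod f f ` parcs G" unfolding ab(1) by (rule rev_image_eqI) simp
  next
    fix p assume "p \<in> map_prod f f ` parcs G"
    then obtain a b where "p = (f a, f b)" "(a, b) \<in> parcs G" by auto
    then show "p \<in> parcs H" using arcs assms(2) by blast
  qed
  then have "with_proj H = app_iso ?h (with_proj G)"
    using im by (simp add: with_proj_def app_iso_def)
  ultimately show ?thesis unfolding digraph_iso_def by blast
qed

lemma digraph_iso_with_projE:
  assumes "digraph_iso (with_proj G) (with_proj H)"
  obtains f where "bij_betw f (pverts G) (pverts H)" "parcs H = map_prod f f ` parcs G"
proof -
  obtain h where h: "pre_digraph.digraph_isomorphism (with_proj G) h"
    and H: "with_proj H = app_iso h (with_proj G)"
    using assms unfolding digraph_iso_def by blast
  \<comment> \<open>Equality of the two digraphs as records forces tail and head to be the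
    projections, so the arc map is determined by the vertex map.\<close>
  have H': "pverts H = iso_verts h ` pverts G" "parcs H = iso_arcs h ` parcs G"
    "iso_tail h = fst" "iso_head h = snd"
    using H by (simp_all add: with_proj_def app_iso_def)
  have "iso_arcs h p = map_prod (iso_verts h) (iso_verts h) p" if "p \<in> parcs G" for p
    using h that H'(3,4) by (auto simp: pre_digraph.digraph_isomorphism_def prod_eq_iff)
  then have "parcs H = map_prod (iso_verts h) (iso_verts h) ` parcs G"
    using H'(2) by (auto simp: image_iff)
  moreover have "bij_betw (iso_verts h) (pverts G) (pverts H)"
    using h H'(1) by (simp add: pre_digraph.digraph_isomorphism_def bij_betw_def)
  ultimately show ?thesis using that by blast
qed

text \<open>Eigenfunctions are transported along the vertex bijection in both directions, so the two
  spectra coincide.\<close>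

lemma graph_spectral_radius_iso:
  assumes "digraph_iso (with_proj G) (with_proj H)"
    and "finite (pverts G)" "parcs G \<subseteq> pverts G \<times> pverts G"
  shows "graph_spectral_radius G = graph_spectral_radius H"
proof -
  obtain f where bij: "bij_betw f (pverts G) (pverts H)" and arcs: "parcs H = map_prod f f ` parcs G"
    using digraph_iso_with_projE[OF assms(1)] .
  let ?V = "pverts G" and ?E = "parcs G" and ?V' = "pverts H" and ?E' = "parcs H"
  have inj: "inj_on f ?V" and im: "f ` ?V = ?V'" using bij by (auto simp: bij_betw_def)
  have nbrs: "?E' `` {f a} = f ` (?E `` {a})" if "a \<in> ?V" for a
  proof -
    have "f c = f a \<Longrightarrow> (c, b) \<in> ?E \<Longrightarrow> c = a" for b c
      using inj that assms(3) by (meson SigmaD1 inj_onD subsetD)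
    then show ?thesis unfolding arcs by (auto simp: image_iff)
  qed
  have sums: "nbr_sum y ?E' (f a) = nbr_sum (y \<circ> f) ?E a" if "a \<in> ?V" for a y
  proof -
    have "inj_on f (?E `` {a})" using inj assms(3) by (auto simp: inj_on_def subset_iff)
    then show ?thesis unfolding nbr_sum_def nbrs[OF that] by (simp add: sum.reindex)
  qed
  have "eigenvalue_on ?V' ?E' k \<longleftrightarrow> eigenvalue_on ?V ?E k" for k
  proof
    assume "eigenvalue_on ?V' ?E' k"
    then obtain y where "\<exists>a\<in>?V'. y a \<noteq> 0" "\<forall>a\<in>?V'. nbr_sum y ?E' a = k * y a"
      unfolding eigenvalue_on_def by blast
    then have "\<exists>a\<in>?V. (y \<circ> f) a \<noteq> 0" "\<forall>a\<in>?V. nbr_sum (y \<circ> f) ?E a = k * (y \<circ> f) a"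
      using sums[of _ y] by (simp_all flip: im)
    then show "eigenvalue_on ?V ?E k" unfolding eigenvalue_on_def by blast
  next
    assume "eigenvalue_on ?V ?E k"
    then obtain x where x: "\<exists>a\<in>?V. x a \<noteq> 0" "\<forall>a\<in>?V. nbr_sum x ?E a = k * x a"
      unfolding eigenvalue_on_def by blast
    let ?y = "x \<circ> the_inv_into ?V f"
    have yf: "?y (f a) = x a" if "a \<in> ?V" for a using inj that by (simp add: the_inv_into_f_f)
    have "nbr_sum ?y ?E' (f a) = k * ?y (f a)" if "a \<in> ?V" for a
    proof -
      have "nbr_sum (?y \<circ> f) ?E a = nbr_sum x ?E a"
        unfolding nbr_sum_def using yf assms(3) by (intro sum.cong) auto
      then show ?thesis using sums[OF that, of ?y] x(2) that yf by simp
    qed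
    moreover have "\<exists>a\<in>?V. ?y (f a) \<noteq> 0" using x(1) yf by metis
    ultimately show "eigenvalue_on ?V' ?E' k"
      unfolding eigenvalue_on_def im[symmetric] by blast
  qed
  moreover have "finite ?V'" "?E' \<subseteq> ?V' \<times> ?V'"
    using assms(2,3) by (auto simp: arcs simp flip: im)
  ultimately show ?thesis
    using assms(2,3) by (simp add: graph_spectral_radius_def spectrum_adjacency_matrix)
qed

text \<open>Adjacency of distinct vertices depends on colours only. Comparison graphs on the
  vertices of \<open>G\<close> and the extremal graphs on pairs both have this form, so isomorphism
  reduces to counting colour classes.\<close>

definition coloured_graph :: "'a set \<Rightarrow> ('a \<Rightarrow> 'c) \<Rightarrow> ('c \<Rightarrow> 'c \<Rightarrow> bool) \<Rightarrow> 'a pair_pre_digraph" where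
  "coloured_graph V c R =
     \<lparr> pverts = V, parcs = {(a, b). a \<in> V \<and> b \<in> V \<and> a \<noteq> b \<and> R (c a) (c b)} \<rparr>"

text \<open>Bijections between classes of the same colour are glued to a colour-preserving bijection
  of the vertices.\<close>

lemma coloured_graph_iso:
  assumes "finite V" "finite V'"
    and card: "\<And>t. card {a \<in> V. c a = t} = card {a \<in> V'. c' a = t}"
  shows "digraph_iso (with_proj (coloured_graph V c R)) (with_proj (coloured_graph V' c' R))"
proof -
  have "\<exists>g. bij_betw g {a \<in> V. c a = t} {a \<in> V'. c' a = t}" for t
    using assms by (intro finite_same_card_bij) auto
  then obtain g where g: "\<And>t. bij_betw (g t) {a \<in> V. c a = t} {a \<in> V'. c' a = t}"
    by metis
  define f where "f a = g (c a) a" for a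
  have f: "f a \<in> V'" "c' (f a) = c a" if "a \<in> V" for a
    using g[of "c a"] that by (auto simp: f_def bij_betw_def)
  have inj: "inj_on f V"
  proof (rule inj_onI)
    fix a b assume ab: "a \<in> V" "b \<in> V" "f a = f b"
    then have "c a = c b" using f by metis
    moreover have "inj_on (g (c b)) {a \<in> V. c a = c b}" using g by (auto simp: bij_betw_def)
    ultimately show "a = b" using ab by (auto simp: f_def inj_on_def)
  qed
  moreover have "f ` V = V'"
  proof (intro equalityI subsetI)
    fix b assume "b \<in> V'"
    then have "b \<in> g (c' b) ` {a \<in> V. c a = c' b}" using g[of "c' b"] by (auto simp: bij_betw_def)
    then obtain a where "a \<in> V" "c a = c' b" "b = g (c' b) a" by blast
    then have "b = f a" by (simp add: f_def)
    then show "b \<in> f ` V" using \<open>a \<in> V\<close> by (rule image_eqI)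
  qed (use f in auto)
  ultimately have "bij_betw f V V'" by (simp add: bij_betw_def)
  then show ?thesis
  proof (intro digraph_iso_with_projI[where f=f])
  qed (auto simp: coloured_graph_def f inj_on_eq_iff[OF inj])
qed

section \<open>Quadratic forms of block graphs\<close>

text \<open>The square of \<open>sum x V\<close> runs over all ordered pairs. These split into the
  arcs, the diagonal \<open>?D\<close>, and the pairs \<open>?M\<close> of differently coloured
  vertices of \<open>W\<close>.\<close>

lemma quad_form_block_graph:
  fixes x :: "'a \<Rightarrow> real" and c :: "'a \<Rightarrow> 'c"
  assumes "finite V" "W \<subseteq> V" "finite T" "c ` W \<subseteq> T"
  shows "quad_form x {(a, b). a \<in> V \<and> b \<in> V \<and> a \<noteq> b \<and> (a \<in> W \<and> b \<in> W \<longrightarrow> c a = c b)} =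
    (sum x V)\<^sup>2 - (sum x W)\<^sup>2 + (\<Sum>t\<in>T. (sum x {a \<in> W. c a = t})\<^sup>2) - (\<Sum>a\<in>V. (x a)\<^sup>2)"
    (is "quad_form x ?E = _")
proof -
  let ?h = "\<lambda>p. x (fst p) * x (snd p)"
  let ?D = "{p. fst p \<in> V \<and> snd p = fst p}"
  let ?M = "{p \<in> W \<times> W. c (fst p) \<noteq> c (snd p)}"
  let ?B = "{p \<in> W \<times> W. c (fst p) = c (snd p)}"
  have fW: "finite W" using assms finite_subset by blast
  have sq: "(sum x A)\<^sup>2 = sum ?h (A \<times> A)" for A
    unfolding power2_eq_square sum_product sum.cartesian_product case_prod_beta ..
  have fin: "finite (V \<times> V)" "finite (W \<times> W)" using assms(1) fW by auto
  have "V \<times> V = (?E \<union> ?D) \<union> ?M" using assms(2) by auto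
  then have "sum ?h (V \<times> V) = sum ?h ((?E \<union> ?D) \<union> ?M)" by (rule arg_cong)
  also have "\<dots> = sum ?h (?E \<union> ?D) + sum ?h ?M"
    by (rule sum.union_disjoint) (auto intro: finite_subset[OF _ fin(1)] finite_subset[OF _ fin(2)])
  also have "sum ?h (?E \<union> ?D) = sum ?h ?E + sum ?h ?D"
    by (rule sum.union_disjoint) (auto intro: finite_subset[OF _ fin(1)])
  finally have 1: "(sum x V)\<^sup>2 = sum ?h ?E + sum ?h ?D + sum ?h ?M" by (simp add: sq)
  have "W \<times> W = ?M \<union> ?B" by auto
  then have "sum ?h (W \<times> W) = sum ?h (?M \<union> ?B)" by (rule arg_cong)
  also have "\<dots> = sum ?h ?M + sum ?h ?B"
    by (rule sum.union_disjoint) (auto intro: finite_subset[OF _ fin(2)])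
  finally have 2: "(sum x W)\<^sup>2 = sum ?h ?M + sum ?h ?B" by (simp add: sq)
  have "sum ?h ?B = (\<Sum>t\<in>T. sum ?h {p \<in> ?B. c (fst p) = t})"
    by (rule sum.group[symmetric]) (use fin assms in \<open>auto intro: finite_subset[OF _ fin(2)]\<close>)
  also have "\<dots> = (\<Sum>t\<in>T. (sum x {a \<in> W. c a = t})\<^sup>2)"
    unfolding sq by (intro sum.cong arg_cong[where f="sum ?h"]) auto
  finally have 3: "sum ?h ?B = (\<Sum>t\<in>T. (sum x {a \<in> W. c a = t})\<^sup>2)" .
  have "?D = (\<lambda>a. (a, a)) ` V" by auto
  then have 4: "sum ?h ?D = (\<Sum>a\<in>V. (x a)\<^sup>2)"
    by (simp add: sum.reindex inj_on_def power2_eq_square)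
  have "quad_form x ?E = sum ?h ?E"
    unfolding quad_form_def by (rule sum.cong) auto
  then show ?thesis
    using 1 2 3 4 by linarith
qed

text \<open>
  The heaviest class \<open>t\<^sub>0\<close> absorbs everything outside \<open>m - 1\<close> chosen subsets of size \<open>p\<close> of other
  classes. Removing mass \<open>X - q\<close> from a class of mass \<open>X\<close> costs
  \<open>X\<^sup>2 - q\<^sup>2 = (X - q) (X + q) \<le> 2 X\<^sub>0 (X - q)\<close>, which the class \<open>t\<^sub>0\<close> of mass \<open>X\<^sub>0\<close> gains back.
\<close>

lemma regroup_classes:
  fixes x :: "'a \<Rightarrow> real" and c :: "'a \<Rightarrow> 'c"
  assumes "finite W" "1 \<le> m" "m \<le> card (c ` W)"
    and size: "\<And>t. t \<in> c ` W \<Longrightarrow> p \<le> card {a \<in> W. c a = t}"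
    and x0: "\<And>a. x a \<ge> 0"
  obtains d :: "'a \<Rightarrow> nat" and t\<^sub>0 where
    "d ` W \<subseteq> {1..m}" "\<And>i. 2 \<le> i \<Longrightarrow> i \<le> m \<Longrightarrow> card {a \<in> W. d a = i} = p"
    "t\<^sub>0 \<in> c ` W" "\<And>a. a \<in> W \<Longrightarrow> c a = t\<^sub>0 \<Longrightarrow> d a = 1"
    "\<And>a b. a \<in> W \<Longrightarrow> b \<in> W \<Longrightarrow> 2 \<le> d a \<Longrightarrow> 2 \<le> d b \<Longrightarrow> c a = c b \<Longrightarrow> d a = d b"
    "(\<Sum>t\<in>c ` W. (sum x {a \<in> W. c a = t})\<^sup>2) \<le> (\<Sum>i\<in>{1..m}. (sum x {a \<in> W. d a = i})\<^sup>2)"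
proof -
  define X where "X t = sum x {a \<in> W. c a = t}" for t
  let ?T = "c ` W"
  have fT: "finite ?T" using assms(1) by simp
  have "?T \<noteq> {}" using assms(2,3) by auto
  then obtain t0 where t0: "t0 \<in> ?T" and max: "\<And>t. t \<in> ?T \<Longrightarrow> X t \<le> X t0"
  proof -
    have "Max (X ` ?T) \<in> X ` ?T" using fT \<open>?T \<noteq> {}\<close> by (intro Max_in) auto
    then obtain t0 where "t0 \<in> ?T" "X t0 = Max (X ` ?T)" by (metis imageE)
    then show ?thesis using that fT by simp
  qed
  have "m - 1 \<le> card (?T - {t0})" using assms(3) t0 fT by simp
  \<comment> \<open>The classes in \<open>D\<close> each supply one small part, numbered 2 to
    \<open>m\<close> by \<open>h\<close>; label 1 takes all the rest.\<close>
  then obtain D where D: "D \<subseteq> ?T - {t0}" "card D = m - 1"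
    using obtain_subset_with_card_n by metis
  have fD: "finite D" using D(1) fT by (meson finite_Diff finite_subset)
  have "card D = card {2..m}" using D(2) by simp
  then obtain h where h: "bij_betw h D {2..m}"
    using finite_same_card_bij[OF fD] by blast
  have "\<exists>Q. Q \<subseteq> {a \<in> W. c a = t} \<and> card Q = p" if "t \<in> D" for t
    using size[of t] that D(1) obtain_subset_with_card_n by (metis DiffD1 subsetD)
  then obtain Q where Q: "\<And>t. t \<in> D \<Longrightarrow> Q t \<subseteq> {a \<in> W. c a = t}" "\<And>t. t \<in> D \<Longrightarrow> card (Q t) = p"
    by metis
  define d where "d a = (if c a \<in> D \<and> a \<in> Q (c a) then h (c a) else 1)" for a
  have img: "{2..m} = h ` D" and inj: "inj_on h D" using h by (auto simp: bij_betw_def)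
  have hD: "2 \<le> h t" "h t \<le> m" if "t \<in> D" for t using h that by (auto simp: bij_betw_def)
  have cls: "{a \<in> W. d a = h t} = Q t" if "t \<in> D" for t
  proof -
    have "a \<in> Q t" if "d a = h t" for a
      using that hD[OF \<open>t \<in> D\<close>] inj_on_eq_iff[OF inj, of "c a" t] \<open>t \<in> D\<close>
      by (auto simp: d_def split: if_splits)
    moreover have "d a = h t" if "a \<in> Q t" for a
      using Q(1)[OF \<open>t \<in> D\<close>] that \<open>t \<in> D\<close> by (auto simp: d_def)
    ultimately show ?thesis using Q(1)[OF that] by blast
  qed
  define q where "q t = (if t \<in> D then sum x (Q t) else 0)" for t
  have q: "0 \<le> q t" "q t \<le> X t" for t
    unfolding q_def X_def using Q(1) assms(1) by (auto intro!: sum_nonneg sum_mono2 x0)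
  have dm: "d ` W \<subseteq> {1..m}" using hD assms(2) by (force simp: d_def)
  have X0: "0 \<le> X t" for t unfolding X_def by (intro sum_nonneg x0)
  let ?Y = "\<Sum>t\<in>?T - {t0}. (X t - q t)"
  \<comment> \<open>Used with the identity for the mass and with the square for the form. Classes
    outside \<open>D\<close> keep mass 0, hence the condition on \<open>F 0\<close>.\<close>
  have qq: "(\<Sum>i\<in>{2..m}. F (sum x {a \<in> W. d a = i})) = (\<Sum>t\<in>?T - {t0}. F (q t))" if "F 0 = 0" for F :: "real \<Rightarrow> real"
  proof -
    have "(\<Sum>i\<in>{2..m}. F (sum x {a \<in> W. d a = i})) = (\<Sum>t\<in>D. F (q t))"
      unfolding img sum.reindex[OF inj] by (intro sum.cong) (auto simp: cls q_def)
    also have "\<dots> = (\<Sum>t\<in>?T - {t0}. F (q t))"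
      by (rule sum.mono_neutral_left) (use D fT that in \<open>auto simp: q_def\<close>)
    finally show ?thesis .
  qed
  have split: "(\<Sum>i\<in>{1..m}. F i) = F 1 + (\<Sum>i\<in>{2..m}. F i)" for F :: "nat \<Rightarrow> real"
    using assms(2) by (simp add: sum.atLeast_Suc_atMost numeral_2_eq_2)
  have "sum x W = (\<Sum>i\<in>{1..m}. sum x {a \<in> W. d a = i})"
    by (rule sum.group[symmetric]) (use assms(1) dm in auto)
  moreover have "sum x W = (\<Sum>t\<in>?T. X t)"
    unfolding X_def by (rule sum.group[symmetric]) (use assms(1) in auto)
  moreover have "(\<Sum>t\<in>?T. X t) = X t0 + (\<Sum>t\<in>?T - {t0}. X t)"
    by (rule sum.remove[OF fT t0])
  ultimately have mass: "sum x {a \<in> W. d a = 1} = X t0 + ?Y"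
    using qq[of "\<lambda>z. z"] split[of "\<lambda>i. sum x {a \<in> W. d a = i}"] by (simp add: sum_subtractf)
  have "(\<Sum>t\<in>?T. (X t)\<^sup>2) = (X t0)\<^sup>2 + (\<Sum>t\<in>?T - {t0}. (X t)\<^sup>2)"
    by (rule sum.remove[OF fT t0])
  also have "(\<Sum>t\<in>?T - {t0}. (X t)\<^sup>2) \<le> (\<Sum>t\<in>?T - {t0}. 2 * X t0 * (X t - q t) + (q t)\<^sup>2)"
  proof (rule sum_mono)
    fix t assume "t \<in> ?T - {t0}"
    then have "(X t + q t) * (X t - q t) \<le> (2 * X t0) * (X t - q t)"
      using q[of t] max[of t] by (intro mult_right_mono) auto
    then show "(X t)\<^sup>2 \<le> 2 * X t0 * (X t - q t) + (q t)\<^sup>2"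
      by (simp add: algebra_simps power2_eq_square)
  qed
  also have "\<dots> = 2 * X t0 * ?Y + (\<Sum>t\<in>?T - {t0}. (q t)\<^sup>2)"
    by (simp add: sum.distrib sum_distrib_left)
  also have "(X t0)\<^sup>2 + \<dots> \<le> (X t0 + ?Y)\<^sup>2 + (\<Sum>t\<in>?T - {t0}. (q t)\<^sup>2)"
    by (simp add: power2_sum)
  also have "\<dots> = (\<Sum>i\<in>{1..m}. (sum x {a \<in> W. d a = i})\<^sup>2)"
    using qq[of "\<lambda>z. z\<^sup>2"] split[of "\<lambda>i. (sum x {a \<in> W. d a = i})\<^sup>2"] mass by simp
  finally have sq: "(\<Sum>t\<in>?T. (X t)\<^sup>2) \<le> (\<Sum>i\<in>{1..m}. (sum x {a \<in> W. d a = i})\<^sup>2)"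
    by simp
  show ?thesis
  proof (rule that[OF dm _ t0])
    fix i assume "2 \<le> i" "i \<le> m"
    then obtain t where "t \<in> D" "i = h t" using img by (metis atLeastAtMost_iff imageE)
    then show "card {a \<in> W. d a = i} = p" using cls Q(2) by simp
  next
    fix a assume "c a = t0"
    then show "d a = 1" using D(1) by (auto simp: d_def)
  next
    fix a b assume "2 \<le> d a" "2 \<le> d b" "c a = c b"
    then show "d a = d b" by (simp add: d_def split: if_splits)
  next
    show "(\<Sum>t\<in>?T. (sum x {a \<in> W. c a = t})\<^sup>2) \<le> (\<Sum>i\<in>{1..m}. (sum x {a \<in> W. d a = i})\<^sup>2)"
      using sq by (simp only: X_def)
  qed
qed


text \<open>The join of the complete graph on \<open>V - W\<close> with the disjoint union of the
  cliques on the colour classes of \<open>W\<close>.\<close>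

definition block_arcs :: "'a set \<Rightarrow> 'a set \<Rightarrow> ('a \<Rightarrow> 'c) \<Rightarrow> 'a rel" where
  "block_arcs V W c = {(a, b). a \<in> V \<and> b \<in> V \<and> a \<noteq> b \<and> (a \<in> W \<and> b \<in> W \<longrightarrow> c a = c b)}"

lemma finite_block_arcs: "finite V \<Longrightarrow> finite (block_arcs V W c)"
  by (rule finite_subset[of _ "V \<times> V"]) (auto simp: block_arcs_def)

text \<open>The bracket is the weight of the ordered pairs of distinct vertices outside
  \<open>S\<close> with an end in \<open>Z\<close>, which are exactly those missing from the
  complete graph.\<close>

lemma quad_form_split_mass:
  fixes x :: "'a \<Rightarrow> real"
  assumes "finite V" "S \<subseteq> V" "Z \<subseteq> V - S"
  shows "quad_form x {(a, b). a \<in> V \<and> b \<in> V \<and> a \<noteq> b \<and> (a \<notin> S \<and> b \<notin> S \<longrightarrow> a \<notin> Z \<and> b \<notin> Z)} =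
    (sum x V)\<^sup>2 - (2 * sum x (V - S - Z) * sum x Z + (sum x Z)\<^sup>2 - (\<Sum>a\<in>Z. (x a)\<^sup>2)) -
      (\<Sum>a\<in>V. (x a)\<^sup>2)"
proof -
  \<comment> \<open>Each vertex of \<open>Z\<close> becomes a class of its own and the others share
    the colour \<open>None\<close>, so the block formula applies.\<close>
  let ?W = "V - S" and ?c = "\<lambda>a. if a \<in> Z then Some a else None"
  have fZ: "finite Z" using assms by (meson finite_Diff finite_subset)
  have 1: "{(a, b). a \<in> V \<and> b \<in> V \<and> a \<noteq> b \<and> (a \<notin> S \<and> b \<notin> S \<longrightarrow> a \<notin> Z \<and> b \<notin> Z)} =
      {(a, b). a \<in> V \<and> b \<in> V \<and> a \<noteq> b \<and> (a \<in> ?W \<and> b \<in> ?W \<longrightarrow> ?c a = ?c b)}"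
    by (auto split: if_splits)
  have 2: "(\<Sum>t\<in>insert None (Some ` Z). (sum x {a \<in> ?W. ?c a = t})\<^sup>2) =
      (sum x (V - S - Z))\<^sup>2 + (\<Sum>a\<in>Z. (x a)\<^sup>2)"
  proof -
    have "{a \<in> ?W. ?c a = None} = V - S - Z" by auto
    moreover have "{a \<in> ?W. ?c a = Some z} = {z}" if "z \<in> Z" for z using that assms(3) by auto
    ultimately show ?thesis using fZ by (simp add: sum.reindex)
  qed
  have 3: "sum x ?W = sum x (V - S - Z) + sum x Z"
    using sum.subset_diff[OF assms(3)] assms(1) by simp
  show ?thesis
    unfolding 1 using 2 3 quad_form_block_graph[of V ?W "insert None (Some ` Z)" ?c x] assms(1) fZ
    by (simp add: image_subset_iff power2_sum)
qed

lemma quad_form_add_vertex: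
  fixes x :: "'a \<Rightarrow> real"
  assumes "finite V" "E \<subseteq> V \<times> V" "N \<subseteq> V" "v \<notin> V"
  shows "quad_form x (E \<union> {v} \<times> N \<union> N \<times> {v}) = quad_form x E + 2 * x v * sum x N"
proof -
  let ?h = "\<lambda>p. x (fst p) * x (snd p)"
  have fin: "finite E" "finite N" using assms finite_rel_on finite_subset by blast+
  have "sum ?h (E \<union> {v} \<times> N \<union> N \<times> {v}) = sum ?h E + sum ?h ({v} \<times> N) + sum ?h (N \<times> {v})"
    using fin assms by (subst sum.union_disjoint, auto)+
  also have "sum ?h ({v} \<times> N) = x v * sum x N"
  proof -
    have "sum ?h ({v} \<times> N) = (\<Sum>a\<in>{v}. \<Sum>b\<in>N. x a * x b)"
      unfolding sum.cartesian_product case_prod_beta ..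
    then show ?thesis by (simp add: sum_distrib_left)
  qed
  also have "sum ?h (N \<times> {v}) = x v * sum x N"
  proof -
    have "sum ?h (N \<times> {v}) = (\<Sum>a\<in>N. \<Sum>b\<in>{v}. x a * x b)"
      unfolding sum.cartesian_product case_prod_beta ..
    then show ?thesis by (simp add: sum_distrib_left mult.commute)
  qed
  finally show ?thesis by (simp add: quad_form_def case_prod_beta)
qed

text \<open>
  A neighbour \<open>y\<close> of the low-degree vertex outside the clique \<open>S\<close> is compared with a non-neighbour \<open>u\<close>
  in \<open>S\<close>: if \<open>u\<close> is at least as heavy, the edge is redirected to \<open>u\<close>, otherwise \<open>u\<close> and \<open>y\<close> exchange
  their roles.
\<close>

lemma move_neighbours_into_clique:
  fixes x :: "'a \<Rightarrow> real" and w :: real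
  defines "miss \<equiv> \<lambda>V S Z. 2 * sum x (V - S - Z) * sum x Z + (sum x Z)\<^sup>2 - (\<Sum>a\<in>Z. (x a)\<^sup>2)"
  assumes "finite V" "S \<subseteq> V" "Z \<subseteq> V - S" "N \<subseteq> V" "card N \<le> card S"
    and "\<And>a. x a \<ge> 0" "w \<ge> 0"
  shows "\<exists>S' Z' N'. S' \<subseteq> V \<and> Z' \<subseteq> V - S' \<and> N' \<subseteq> S' \<and>
    card S' = card S \<and> card Z' = card Z \<and> card N' = card N \<and>
    miss V S' Z' - 2 * w * sum x N' \<le> miss V S Z - 2 * w * sum x N"
  using assms(3-6)
\<comment> \<open>Each round removes one neighbour from outside the clique; an exchange also changes
  \<open>S\<close> and possibly \<open>Z\<close>.\<close>
proof (induction "card (N - S)" arbitrary: S Z N)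
  case 0
  then have "N \<subseteq> S" using \<open>finite V\<close> by (metis card_0_eq Diff_eq_empty_iff finite_Diff finite_subset)
  then show ?case using 0 by blast
next
  case (Suc k)
  have fin: "finite S" "finite Z" "finite N"
    using Suc.prems \<open>finite V\<close> by (meson finite_Diff finite_subset)+
  obtain y where y: "y \<in> N - S" using Suc(2) by (metis card.empty ex_in_conv nat.distinct(1))
  \<comment> \<open>Since \<open>N\<close> is no larger than \<open>S\<close>, a neighbour outside
    \<open>S\<close> leaves room for a non-neighbour inside.\<close>
  have "card (N - S) \<le> card (S - N)"
    using Suc.prems(4) fin by (metis card_le_sym_Diff)
  then obtain u where u: "u \<in> S - N" using Suc(2) by (metis card.empty ex_in_conv not_less_eq_eq zero_le)
  have yV: "y \<in> V" and uV: "u \<in> V" "u \<noteq> y" "u \<notin> Z" using y u Suc.prems by auto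
  show ?case
  proof (cases "x y \<le> x u")
    case True
    let ?N = "insert u (N - {y})"
    have "?N - S = N - S - {y}" using u by auto
    then have k: "k = card (?N - S)" using Suc(2) y fin by simp
    have cN: "card ?N = card N"
      using y u fin by (metis DiffD1 DiffD2 card_Suc_Diff1 card_insert_disjoint finite_Diff insert_Diff insert_iff)
    have N: "?N \<subseteq> V" "card ?N \<le> card S" using Suc.prems(3,4) uV cN by auto
    obtain S' Z' N' where "S' \<subseteq> V" "Z' \<subseteq> V - S'" "N' \<subseteq> S'" "card S' = card S" "card Z' = card Z"
      "card N' = card ?N" and le: "miss V S' Z' - 2 * w * sum x N' \<le> miss V S Z - 2 * w * sum x ?N"
      using Suc(1)[OF k Suc.prems(1,2) N] by blast
    moreover have "sum x ?N = sum x N - x y + x u"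
      using y u fin by (simp add: sum_diff1)
    then have "w * sum x N \<le> w * sum x ?N"
      using True \<open>w \<ge> 0\<close> by (intro mult_left_mono) auto
    ultimately show ?thesis
      using cN by (intro exI[of _ S'] exI[of _ Z'] exI[of _ N']) auto
  next
    case False
    \<comment> \<open>After the exchange \<open>u\<close> takes the former place of
      \<open>y\<close>: in \<open>Z\<close> if \<open>y\<close> was there, otherwise in the
      remaining part.\<close>
    let ?S = "insert y (S - {u})" and ?Z = "if y \<in> Z then insert u (Z - {y}) else Z"
    have "N - ?S = N - S - {y}" using u by auto
    then have k: "k = card (N - ?S)" using Suc(2) y fin by simp
    have cS: "card ?S = card S" using y u fin
      by (metis DiffD1 DiffD2 card_Suc_Diff1 card_insert_disjoint finite_Diff insert_Diff insert_iff)
    have "card (insert u (Z - {y})) = card Z" if "y \<in> Z"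
      using uV fin that by (metis DiffD1 card_Suc_Diff1 card_insert_disjoint finite_Diff)
    then have cZ: "card ?Z = card Z" by simp
    have *: "?S \<subseteq> V" "?Z \<subseteq> V - ?S" using Suc.prems(1,2) yV uV u by auto
    have "miss V ?S ?Z \<le> miss V S Z"
    proof (cases "y \<in> Z")
      case True
      then have Z: "?Z = insert u (Z - {y})" by simp
      have R: "V - ?S - insert u (Z - {y}) = V - S - Z" using True u y uV yV by auto
      have sums: "sum x (insert u (Z - {y})) = sum x Z - x y + x u"
        "(\<Sum>a\<in>insert u (Z - {y}). (x a)\<^sup>2) = (\<Sum>a\<in>Z. (x a)\<^sup>2) - (x y)\<^sup>2 + (x u)\<^sup>2"
        using True uV fin by (simp_all add: sum_diff1)
      \<comment> \<open>The second factor is the mass of the vertices outside \<open>S\<close> other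
        than \<open>y\<close>, which lose the heavier partner \<open>y\<close> and get the lighter
        \<open>u\<close> in the missing pairs.\<close>
      have "miss V S Z - miss V ?S ?Z =
          2 * (x y - x u) * (sum x (V - S - Z) + (sum x Z - x y))"
        unfolding miss_def Z R sums by (simp add: algebra_simps power2_eq_square)
      moreover have "0 \<le> sum x (V - S - Z)" "0 \<le> sum x Z - x y"
        using True fin assms(7) member_le_sum[of y Z x] by (auto intro!: sum_nonneg)
      ultimately show ?thesis
        using False by (smt (verit) mult_nonneg_nonneg)
    next
      case yZ: False
      then have Z: "?Z = Z" by simp
      have R: "V - ?S - Z = insert u (V - S - Z - {y})" using yZ u y uV yV by auto
      have sums: "sum x (insert u (V - S - Z - {y})) = sum x (V - S - Z) - x y + x u"
        using yZ u y uV yV \<open>finite V\<close> by (simp add: sum_diff1)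
      have "miss V S Z - miss V ?S ?Z = 2 * (x y - x u) * sum x Z"
        unfolding miss_def Z R sums by (simp add: algebra_simps)
      moreover have "0 \<le> sum x Z" by (intro sum_nonneg assms(7))
      ultimately show ?thesis
        using False by (smt (verit) mult_nonneg_nonneg)
    qed
    moreover have "card N \<le> card ?S" using Suc.prems(4) cS by simp
    then obtain S' Z' N' where "S' \<subseteq> V" "Z' \<subseteq> V - S'" "N' \<subseteq> S'" "card S' = card ?S"
      "card Z' = card ?Z" "card N' = card N"
      "miss V S' Z' - 2 * w * sum x N' \<le> miss V ?S ?Z - 2 * w * sum x N"
      using Suc(1)[OF k *(1) *(2) Suc.prems(3)] by blast
    ultimately show ?thesis
      using cS cZ by (intro exI[of _ S'] exI[of _ Z'] exI[of _ N']) auto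
  qed
qed

text \<open>First all arcs compatible with the cut are added, which does not decrease the form at a
  nonnegative vector. The block formula then reduces the comparison to the sums of squares of class
  masses.\<close>

lemma quad_form_regroup:
  fixes x :: "'a \<Rightarrow> real" and c :: "'a \<Rightarrow> 'c"
  assumes "finite V" "E \<subseteq> V \<times> V" "irrefl E" "W \<subseteq> V"
    and cE: "\<And>a b. (a, b) \<in> E \<Longrightarrow> a \<in> W \<Longrightarrow> b \<in> W \<Longrightarrow> c a = c b"
    and "1 \<le> m" "m \<le> card (c ` W)"
    and size: "\<And>t. t \<in> c ` W \<Longrightarrow> p \<le> card {a \<in> W. c a = t}"
    and x0: "\<And>a. x a \<ge> 0"
  obtains d :: "'a \<Rightarrow> nat" and t\<^sub>0 where
    "d ` W \<subseteq> {1..m}" "\<And>i. 2 \<le> i \<Longrightarrow> i \<le> m \<Longrightarrow> card {a \<in> W. d a = i} = p"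
    "t\<^sub>0 \<in> c ` W" "\<And>a. a \<in> W \<Longrightarrow> c a = t\<^sub>0 \<Longrightarrow> d a = 1"
    "\<And>a b. a \<in> W \<Longrightarrow> b \<in> W \<Longrightarrow> 2 \<le> d a \<Longrightarrow> 2 \<le> d b \<Longrightarrow> c a = c b \<Longrightarrow> d a = d b"
    "quad_form x E \<le> quad_form x (block_arcs V W d)"
proof -
  have fW: "finite W" using assms(1,4) finite_subset by blast
  obtain d :: "'a \<Rightarrow> nat" and t\<^sub>0 where d:
    "d ` W \<subseteq> {1..m}" "\<And>i. 2 \<le> i \<Longrightarrow> i \<le> m \<Longrightarrow> card {a \<in> W. d a = i} = p"
    "t\<^sub>0 \<in> c ` W" "\<And>a. a \<in> W \<Longrightarrow> c a = t\<^sub>0 \<Longrightarrow> d a = 1"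
    "\<And>a b. a \<in> W \<Longrightarrow> b \<in> W \<Longrightarrow> 2 \<le> d a \<Longrightarrow> 2 \<le> d b \<Longrightarrow> c a = c b \<Longrightarrow> d a = d b"
    and sq: "(\<Sum>t\<in>c ` W. (sum x {a \<in> W. c a = t})\<^sup>2) \<le> (\<Sum>i\<in>{1..m}. (sum x {a \<in> W. d a = i})\<^sup>2)"
    by (rule regroup_classes[OF fW assms(6,7), of p x])
      (rule size, assumption, rule x0, rule that, assumption+)
  have "E \<subseteq> block_arcs V W c"
    using assms(2,3) cE by (auto simp: block_arcs_def irrefl_def)
  then have "quad_form x E \<le> quad_form x (block_arcs V W c)"
    by (rule quad_form_mono[OF finite_block_arcs[OF assms(1)] _ x0])
  also have "\<dots> \<le> quad_form x (block_arcs V W d)"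
    using quad_form_block_graph[OF assms(1,4) finite_imageI[OF fW, of c] subset_refl, of x]
      quad_form_block_graph[OF assms(1,4) finite_atLeastAtMost d(1), of x] sq
    by (simp add: block_arcs_def)
  finally have quad: "quad_form x E \<le> quad_form x (block_arcs V W d)" .
  show ?thesis by (rule that[of d t\<^sub>0]) (fact d quad)+
qed


section \<open>Comparison with the extremal graphs\<close>

text \<open>Colour 0 is the join set; every other colour class is one clique of the remaining
  graph.\<close>

definition join_rel :: "nat \<Rightarrow> nat \<Rightarrow> bool" where
  "join_rel s t \<longleftrightarrow> s = 0 \<or> t = 0 \<or> s = t"

text \<open>
  Colour 4 is the vertex of degree \<open>\<delta>\<close>, its neighbours have colour 3 and the rest of the join
  set colour 0; colour 1 is the large clique and colour 2 the remaining isolated vertices.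
\<close>

definition pendant_rel :: "nat \<Rightarrow> nat \<Rightarrow> bool" where
  "pendant_rel s t \<longleftrightarrow> s = 4 \<and> t = 3 \<or> s = 3 \<and> t = 4 \<or>
     s \<noteq> 4 \<and> t \<noteq> 4 \<and> (s \<in> {0, 3} \<or> t \<in> {0, 3} \<or> s = 1 \<and> t = 1)"

lemma parcs_coloured_graph:
  "parcs (coloured_graph V c R) = {(a, b). a \<in> V \<and> b \<in> V \<and> a \<noteq> b \<and> R (c a) (c b)}"
  "pverts (coloured_graph V c R) = V"
  by (simp_all add: coloured_graph_def)

lemma sum_const_classes:
  assumes "finite W" "d ` W \<subseteq> {1..m}" "1 \<le> m"
    and "\<And>i. 2 \<le> i \<Longrightarrow> i \<le> m \<Longrightarrow> card {a \<in> W. d a = i} = p"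
  shows "card W = card {a \<in> W. d a = (1::nat)} + (m - 1) * p"
    and "card {a \<in> W. 2 \<le> d a} = (m - 1) * p"
proof -
  have eq: "card {a \<in> W. 2 \<le> d a} = (\<Sum>i\<in>{2..m}. card {a \<in> {a \<in> W. 2 \<le> d a}. d a = i})"
    unfolding card_eq_sum by (rule sum.group[symmetric]) (use assms(1,2) in auto)
  have "{a \<in> {a \<in> W. 2 \<le> d a}. d a = i} = {a \<in> W. d a = i}" if "2 \<le> i" for i
    using that by auto
  then show 2: "card {a \<in> W. 2 \<le> d a} = (m - 1) * p"
    unfolding eq using assms(4) by simp
  have "W = {a \<in> W. d a = 1} \<union> {a \<in> W. 2 \<le> d a}" using assms(2) by fastforce
  then have "card W = card ({a \<in> W. d a = 1} \<union> {a \<in> W. 2 \<le> d a})" by (rule arg_cong)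
  also have "\<dots> = card {a \<in> W. d a = 1} + card {a \<in> W. 2 \<le> d a}"
    by (rule card_Un_disjoint) (use assms(1) in auto)
  finally show "card W = card {a \<in> W. d a = 1} + (m - 1) * p" using 2 by simp
qed

lemma rel_eqI: "(\<And>a. E `` {a} = F `` {a}) \<Longrightarrow> E = F"
  by (metis Image_singleton_iff subrelI subset_antisym)

text \<open>Regrouping may delete arcs of \<open>E\<close>, so \<open>E\<close> need not lie in the
  new graph. The rigidity part starts from the class \<open>t\<^sub>0\<close>, which loses no
  arcs.\<close>

lemma join_comparison:
  fixes x :: "'a \<Rightarrow> real" and c :: "'a \<Rightarrow> 'c"
  assumes "finite V" "E \<subseteq> V \<times> V" "irrefl E" "sym E" "S \<subseteq> V"
    and cE: "\<And>a b. (a, b) \<in> E \<Longrightarrow> a \<in> V - S \<Longrightarrow> b \<in> V - S \<Longrightarrow> c a = c b"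
    and "1 \<le> m" "m \<le> card (c ` (V - S))"
    and size: "\<And>t. t \<in> c ` (V - S) \<Longrightarrow> p \<le> card {a \<in> V - S. c a = t}"
    and x0: "\<And>a. x a \<ge> 0" and xpos: "\<And>a. a \<in> V \<Longrightarrow> x a > 0"
  obtains d :: "'a \<Rightarrow> nat" where
    "\<And>t. card {a \<in> V. d a = t} =
      (if t = 0 then card S else if t = 1 then card V - card S - (m - 1) * p
       else if t \<le> m then p else 0)"
    "quad_form x E \<le> quad_form x (parcs (coloured_graph V d join_rel))"
    "(\<forall>a\<in>V. nbr_sum x E a = nbr_sum x (parcs (coloured_graph V d join_rel)) a) \<longrightarrow>
      E = parcs (coloured_graph V d join_rel)"
proof -
  let ?W = "V - S"
  have fS: "finite S" using assms(1,5) finite_subset by blast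
  obtain e :: "'a \<Rightarrow> nat" and t\<^sub>0 where e:
    "e ` ?W \<subseteq> {1..m}" "\<And>i. 2 \<le> i \<Longrightarrow> i \<le> m \<Longrightarrow> card {a \<in> ?W. e a = i} = p"
    "t\<^sub>0 \<in> c ` ?W" "\<And>a. a \<in> ?W \<Longrightarrow> c a = t\<^sub>0 \<Longrightarrow> e a = 1"
    "\<And>a b. a \<in> ?W \<Longrightarrow> b \<in> ?W \<Longrightarrow> 2 \<le> e a \<Longrightarrow> 2 \<le> e b \<Longrightarrow> c a = c b \<Longrightarrow> e a = e b"
    and quad: "quad_form x E \<le> quad_form x (block_arcs V ?W e)"
    by (rule quad_form_regroup[OF assms(1-3) Diff_subset cE assms(7,8), of p x])
      (assumption, assumption, assumption, rule size, assumption, rule x0, rule that, assumption+)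
  define d where "d a = (if a \<in> S then 0 else e a)" for a
  define F where "F = parcs (coloured_graph V d join_rel)"
  have e1: "1 \<le> e a" "e a \<le> m" if "a \<in> ?W" for a using e(1) that by auto
  have F: "(a, b) \<in> F \<longleftrightarrow> a \<in> V \<and> b \<in> V \<and> a \<noteq> b \<and> (a \<in> S \<or> b \<in> S \<or> e a = e b)" for a b
    using e1[of a] e1[of b] by (auto simp: F_def parcs_coloured_graph join_rel_def d_def)
  have FV: "F \<subseteq> V \<times> V" "sym F" by (auto simp: F sym_def)
  have fin: "finite E" "finite F" using finite_rel_on assms(1,2) FV by blast+
  have "block_arcs V ?W e = F" by (auto simp: F block_arcs_def)
  then have quadF: "quad_form x E \<le> quad_form x F" using quad by simp
  have cls0: "{a \<in> V. d a = 0} = S" using assms(5) e1 by (force simp: d_def)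
  have cls: "{a \<in> V. d a = t} = {a \<in> ?W. e a = t}" if "t \<noteq> 0" for t
    using that by (auto simp: d_def)
  have cW: "card ?W = card {a \<in> ?W. e a = 1} + (m - 1) * p"
    using sum_const_classes(1)[OF _ e(1) assms(7) e(2)] assms(1) by simp
  have cVS: "card ?W = card V - card S" "card S \<le> card V"
    using assms(1,5) fS by (simp_all add: card_Diff_subset card_mono)
  have cards: "card {a \<in> V. d a = t} =
      (if t = 0 then card S else if t = 1 then card V - card S - (m - 1) * p
       else if t \<le> m then p else 0)" for t
  proof -
    consider "t = 0" | "t = 1" | "2 \<le> t" "t \<le> m" | "2 \<le> t" "m < t" by linarith
    then show ?thesis
    proof cases
      case 1
      then show ?thesis using cls0 by simp
    next
      case 2
      have "card {a \<in> ?W. e a = 1} = card V - card S - (m - 1) * p" using cW cVS by linarith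
      then show ?thesis using 2 cls[of 1] by simp
    next
      case 3
      then show ?thesis using cls[of t] e(2) by simp
    next
      case 4
      have "e a \<noteq> t" if "a \<in> ?W" for a using e1(2)[OF that] 4(2) by simp
      then have "{a \<in> ?W. e a = t} = {}" by blast
      then have "card {a \<in> V. d a = t} = 0" using cls[of t] 4 by (simp only: card.empty)
      then show ?thesis using 4 by simp
    qed
  qed
  have rigid: "(\<forall>a\<in>V. nbr_sum x E a = nbr_sum x F a) \<longrightarrow> E = F"
  proof
    assume "\<forall>a\<in>V. nbr_sum x E a = nbr_sum x F a"
    then have eq: "nbr_sum x E a = nbr_sum x F a" if "a \<in> V" for a using that by blast
    have nF: "E `` {a} = F `` {a}" if "a \<in> V" "E `` {a} \<subseteq> F `` {a}" for a
      by (rule nbrs_eq_of_nbr_sum_eq[OF fin(2) that(2) _ eq[OF that(1)]]) (use FV(1) xpos in auto)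
    have EV: "E `` {a} \<subseteq> V - {a}" for a using assms(2,3) by (auto simp: irrefl_def)
    have symE: "(b, a) \<in> E" if "(a, b) \<in> E" for a b using assms(4) that by (meson symD)
    obtain a0 where a0: "a0 \<in> ?W" "c a0 = t\<^sub>0" using e(3) by auto
    \<comment> \<open>Neighbours of \<open>a\<close> lie in \<open>S\<close> or in the same class,
      which is wholly labelled 1, so they remain neighbours.\<close>
    have C0: "E `` {a} = F `` {a}" if a: "a \<in> ?W" "c a = t\<^sub>0" for a
    proof (rule nF)
      show "E `` {a} \<subseteq> F `` {a}"
      proof
        fix b assume "b \<in> E `` {a}"
        then have "(a, b) \<in> E" by simp
        then show "b \<in> F `` {a}"
          using EV[of a] cE[of a b] a e(4)[of a] e(4)[of b] by (auto simp: F)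
      qed
    qed (use a in auto)
    \<comment> \<open>Label 1 is a clique of the new graph, so \<open>b\<close> is adjacent to
      \<open>a0\<close> already in \<open>E\<close> and belongs to the same class: nothing was
      merged into it.\<close>
    have R: "c b = t\<^sub>0" if "b \<in> ?W" "e b = 1" for b
    proof (cases "b = a0")
      case False
      then have "(a0, b) \<in> F" using that a0 e(4)[of a0] by (auto simp: F)
      then have "(a0, b) \<in> E" using C0[OF a0] by auto
      then show ?thesis using cE[of a0 b] a0 that by auto
    qed (use a0 in simp)
    \<comment> \<open>Arcs at label 1 are settled, and two vertices of one class with labels at
      least 2 share their label. Hence no arc was lost at all.\<close>
    have "E `` {a} \<subseteq> F `` {a}" if a: "a \<in> V" for a
    proof
      fix b assume "b \<in> E `` {a}"
      then have ab: "(a, b) \<in> E" by simp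
      then have "b \<in> V" using assms(2) by auto
      consider "a \<in> S \<or> b \<in> S" | "a \<in> ?W" "e a = 1" | "b \<in> ?W" "e b = 1" |
        "a \<in> ?W" "b \<in> ?W" "2 \<le> e a" "2 \<le> e b"
        using e1[of a] e1[of b] a \<open>b \<in> V\<close> by fastforce
      then have "(a, b) \<in> F"
      proof cases
        case 1 then show ?thesis using EV[of a] ab a by (auto simp: F)
      next
        case 2 then show ?thesis using C0[of a] R[of a] ab by auto
      next
        case 3 then show ?thesis using C0[of b] R[of b] symE[OF ab] FV(2) by (auto dest: symD)
      next
        case 4 then show ?thesis using e(5)[of a b] cE[OF ab] EV[of a] ab by (auto simp: F)
      qed
      then show "b \<in> F `` {a}" by simp
    qed
    then have "E `` {a} = F `` {a}" for a
      using nF[of a] assms(2) FV(1) by (cases "a \<in> V") auto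
    then show "E = F" by (rule rel_eqI)
  qed
  show ?thesis
    by (rule that[of d]) (fact cards quadF[unfolded F_def] rigid[unfolded F_def])+
qed

text \<open>The form splits into that of the graph without \<open>v\<close> and the edges at
  \<open>v\<close>. The former is regrouped with parts of size 1, then the neighbours of
  \<open>v\<close> are moved into the join set at no loss.\<close>

lemma pendant_comparison:
  fixes x :: "'a \<Rightarrow> real" and c :: "'a \<Rightarrow> 'c" and \<kappa> \<delta> :: nat
  assumes "finite V" "E \<subseteq> V \<times> V" "irrefl E" "sym E" "v \<in> V" "W \<subseteq> V - {v}"
    and cE: "\<And>a b. (a, b) \<in> E \<Longrightarrow> a \<in> W \<Longrightarrow> b \<in> W \<Longrightarrow> c a = c b"
    and "1 \<le> m" "m \<le> card (c ` W)"
    and \<delta>: "card (E `` {v}) = \<delta>" and \<kappa>: "card (V - {v} - W) = \<kappa>" and "\<delta> \<le> \<kappa>"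
    and x0: "\<And>a. x a \<ge> 0" and xpos: "\<And>a. a \<in> V \<Longrightarrow> x a > 0"
  obtains d :: "'a \<Rightarrow> nat" where
    "\<And>t. card {a \<in> V. d a = t} =
      (if t = 0 then \<kappa> - \<delta> else if t = 1 then card V - \<kappa> - m else if t = 2 then m - 1
       else if t = 3 then \<delta> else if t = 4 then 1 else 0)"
    "quad_form x E \<le> quad_form x (parcs (coloured_graph V d pendant_rel))"
    "(\<forall>a\<in>V. nbr_sum x E a = nbr_sum x (parcs (coloured_graph V d pendant_rel)) a) \<longrightarrow>
      E = parcs (coloured_graph V d pendant_rel)"
proof -
  define U where "U = V - {v}"
  define E' where "E' = E \<inter> U \<times> U"
  define N where "N = E `` {v}"
  define split where "split S Z = {(a, b). a \<in> U \<and> b \<in> U \<and> a \<noteq> b \<and>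
    (a \<notin> S \<and> b \<notin> S \<longrightarrow> a \<notin> Z \<and> b \<notin> Z)}" for S Z
  define miss where "miss S Z = 2 * sum x (U - S - Z) * sum x Z + (sum x Z)\<^sup>2 - (\<Sum>a\<in>Z. (x a)\<^sup>2)"
    for S Z
  have fU: "finite U" and vU: "v \<notin> U" and VU: "V = insert v U" and WU: "W \<subseteq> U"
    using assms(1,5,6) by (auto simp: U_def)
  have fW: "finite W" using fU WU finite_subset by blast
  have N: "N \<subseteq> U" using assms(2,3) by (auto simp: N_def U_def irrefl_def)
  have symE: "(b, a) \<in> E" if "(a, b) \<in> E" for a b using assms(4) that by (meson symD)
  have E: "E = E' \<union> {v} \<times> N \<union> N \<times> {v}"
    using assms(2,3) by (auto simp: E'_def N_def U_def irrefl_def dest: symE)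
  have E': "E' \<subseteq> U \<times> U" "irrefl E'" using assms(3) by (auto simp: E'_def irrefl_def)
  have cE': "c a = c b" if "(a, b) \<in> E'" "a \<in> W" "b \<in> W" for a b
    using cE that by (simp add: E'_def)
  have size: "1 \<le> card {a \<in> W. c a = t}" if "t \<in> c ` W" for t
    using that fW by (auto simp: Suc_le_eq card_gt_0_iff)
  obtain e :: "'a \<Rightarrow> nat" and t\<^sub>0 where e:
    "e ` W \<subseteq> {1..m}" "\<And>i. 2 \<le> i \<Longrightarrow> i \<le> m \<Longrightarrow> card {a \<in> W. e a = i} = 1"
    and quad: "quad_form x E' \<le> quad_form x (block_arcs U W e)"
    by (rule quad_form_regroup[OF fU E' WU cE' assms(8,9), of 1 x])
      (assumption, assumption, assumption, rule size, assumption, rule x0, rule that, assumption+)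
  define S where "S = U - W"
  define Z where "Z = {a \<in> W. 2 \<le> e a}"
  have SU: "S \<subseteq> U" and ZU: "Z \<subseteq> U - S" using WU by (auto simp: S_def Z_def)
  have cS: "card S = \<kappa>" using \<kappa> by (simp add: S_def U_def)
  have cN: "card N = \<delta>" using \<delta> by (simp add: N_def)
  have cZ: "card Z = m - 1"
    using sum_const_classes(2)[OF fW e(1) assms(8) e(2)] by (simp add: Z_def)
  have "block_arcs U W e \<subseteq> split S Z"
  proof -
    \<comment> \<open>Classes with label at least 2 are single vertices, so arcs inside a class
      occur only for label 1.\<close>
    have "a = b" if "a \<in> W" "b \<in> W" "e a = e b" "2 \<le> e a" for a b
    proof -
      have "card {z \<in> W. e z = e a} = 1" using e that by auto
      then obtain z where "{z \<in> W. e z = e a} = {z}" using card_1_singletonE by blast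
      then show ?thesis using that by (metis (mono_tags, lifting) mem_Collect_eq singletonD)
    qed
    then show ?thesis by (fastforce simp: block_arcs_def split_def S_def Z_def)
  qed
  moreover have fsplit: "finite (split S Z)" for S Z
    by (rule finite_subset[of _ "U \<times> U"]) (auto simp: split_def fU)
  ultimately have "quad_form x (block_arcs U W e) \<le> quad_form x (split S Z)"
    by (intro quad_form_mono x0)
  have quad_split: "quad_form x (split S Z) = (sum x U)\<^sup>2 - miss S Z - (\<Sum>a\<in>U. (x a)\<^sup>2)"
    if "S \<subseteq> U" "Z \<subseteq> U - S" for S Z
    unfolding split_def miss_def by (rule quad_form_split_mass[OF fU that])
  have "card N \<le> card S" using cS cN assms(12) by simp
  \<comment> \<open>With weight \<open>x v\<close>, the quantity controlled is the missing weight
    minus the contribution of the edges at \<open>v\<close>.\<close>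
  obtain S' Z' N' where *: "S' \<subseteq> U" "Z' \<subseteq> U - S'" "N' \<subseteq> S'"
    "card S' = card S" "card Z' = card Z" "card N' = card N"
    and le: "miss S' Z' - 2 * x v * sum x N' \<le> miss S Z - 2 * x v * sum x N"
    using move_neighbours_into_clique[where x=x and w="x v",
        OF fU SU ZU N \<open>card N \<le> card S\<close> x0 x0, folded miss_def]
    by (elim exE conjE) (rule that)
  define d where "d a = (if a = v then 4 else if a \<in> N' then 3 else if a \<in> S' then 0
    else if a \<in> Z' then 2 else 1 :: nat)" for a
  define F where "F = parcs (coloured_graph V d pendant_rel)"
  have F: "(a, b) \<in> F \<longleftrightarrow> a = v \<and> b \<in> N' \<or> a \<in> N' \<and> b = v \<or>
      a \<in> U \<and> b \<in> U \<and> a \<noteq> b \<and> (a \<in> S' \<or> b \<in> S' \<or> a \<notin> Z' \<and> b \<notin> Z')" for a b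
    using * vU by (auto simp: F_def parcs_coloured_graph pendant_rel_def d_def VU)
  have FV: "F \<subseteq> V \<times> V" using * by (auto simp: F VU)
  have symF: "(b, a) \<in> F" if "(a, b) \<in> F" for a b using that unfolding F by blast
  have fin: "finite E" "finite F" using finite_rel_on assms(1,2) FV by blast+
  have N'U: "N' \<subseteq> U" using * by blast
  have "F = split S' Z' \<union> {v} \<times> N' \<union> N' \<times> {v}"
    by (auto simp: F split_def)
  then have "quad_form x F = quad_form x (split S' Z') + 2 * x v * sum x N'"
    using quad_form_add_vertex[OF fU _ N'U vU, of "split S' Z'" x] by (auto simp: split_def)
  moreover have "quad_form x E = quad_form x E' + 2 * x v * sum x N"
    unfolding E by (rule quad_form_add_vertex[OF fU E'(1) N vU])
  ultimately have quadF: "quad_form x E \<le> quad_form x F"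
    using quad \<open>quad_form x (block_arcs U W e) \<le> quad_form x (split S Z)\<close> le
      quad_split[OF SU ZU] quad_split[OF *(1,2)] by linarith
  have fin': "finite S'" "finite Z'" "finite N'" using * fU by (meson finite_Diff finite_subset)+
  have cards: "card {a \<in> V. d a = t} =
      (if t = 0 then \<kappa> - \<delta> else if t = 1 then card V - \<kappa> - m else if t = 2 then m - 1
       else if t = 3 then \<delta> else if t = 4 then 1 else 0)" for t
  proof -
    have "{a \<in> V. d a = 4} = {v}" "{a \<in> V. d a = 3} = N'" "{a \<in> V. d a = 2} = Z'"
      "{a \<in> V. d a = 0} = S' - N'" "{a \<in> V. d a = 1} = U - S' - Z'"
      using * vU by (auto simp: d_def VU)
    moreover have "card (U - S' - Z') = card V - \<kappa> - m"
    proof -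
      have "card (U - S' - Z') = card U - card S' - card Z'"
        using * fin' fU by (simp add: card_Diff_subset)
      then show ?thesis using * cS cZ vU fU assms(8) by (simp add: VU)
    qed
    moreover have "{a \<in> V. d a = t} = {}" if "t \<notin> {0, 1, 2, 3, 4}"
      using that by (auto simp: d_def)
    then have "card {a \<in> V. d a = t} = 0" if "t \<notin> {0, 1, 2, 3, 4}"
      using that by (metis card.empty)
    ultimately show ?thesis
      using * fin' cS cZ cN by (cases "t \<in> {0, 1, 2, 3, 4}") (auto simp: card_Diff_subset)
  qed
  have rigid: "(\<forall>a\<in>V. nbr_sum x E a = nbr_sum x F a) \<longrightarrow> E = F"
  proof
    assume "\<forall>a\<in>V. nbr_sum x E a = nbr_sum x F a"
    then have eq: "nbr_sum x E a = nbr_sum x F a" if "a \<in> V" for a using that by blast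
    have sub: "E `` {a} = F `` {a}" if "a \<in> V" "E `` {a} \<subseteq> F `` {a}" for a
      by (rule nbrs_eq_of_nbr_sum_eq[OF fin(2) that(2) _ eq[OF that(1)]]) (use FV(1) xpos in auto)
    have sup: "E `` {a} = F `` {a}" if "a \<in> V" "F `` {a} \<subseteq> E `` {a}" for a
      by (rule nbrs_eq_of_nbr_sum_eq[OF fin(1) that(2) _ eq[OF that(1), symmetric], symmetric])
        (use assms(2) xpos in auto)
    have EV: "b \<in> V" "b \<noteq> a" if "(a, b) \<in> E" for a b
      using assms(2,3) that by (auto simp: irrefl_def)
    have EVU: "E `` {a} \<subseteq> insert v U - {a}" for a using EV VU by blast
    \<comment> \<open>In \<open>F\<close> a vertex of \<open>N'\<close> is adjacent to all others,
      so its neighbourhoods coincide and it is adjacent to \<open>v\<close> in \<open>E\<close>.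
      Equal cardinalities then give \<open>N' = N\<close>.\<close>
    have "N' \<subseteq> N"
    proof
      fix a assume a: "a \<in> N'"
      then have "a \<in> U" "a \<in> S'" using * by auto
      then have "E `` {a} = F `` {a}"
        using a EVU[of a] by (intro sub) (auto simp: F VU)
      moreover have "(a, v) \<in> F" using a by (simp add: F)
      ultimately have "(a, v) \<in> E" by blast
      then show "a \<in> N" using symE by (simp add: N_def)
    qed
    then have NN: "N' = N" using * N fU by (metis card_subset_eq finite_subset)
    have v: "E `` {v} = F `` {v}" using vU NN by (auto simp: F N_def)
    have S: "E `` {a} = F `` {a}" if "a \<in> S'" for a
    proof (rule sub)
      show "E `` {a} \<subseteq> F `` {a}"
      proof
        fix b assume "b \<in> E `` {a}"
        then show "b \<in> F `` {a}"
          using that * EVU[of a] NN symE[of a v] by (cases "b = v") (auto simp: F N_def)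
      qed
    qed (use that * VU in auto)
    \<comment> \<open>Here the inclusion is reversed: in \<open>F\<close> such a vertex sees only
      \<open>S'\<close>, where the neighbourhoods already agree.\<close>
    have Z: "E `` {a} = F `` {a}" if "a \<in> Z'" for a
    proof (rule sup)
      show "F `` {a} \<subseteq> E `` {a}"
      proof
        fix b assume "b \<in> F `` {a}"
        then have "(a, b) \<in> F" "b \<in> S'" using that * vU by (auto simp: F)
        then show "b \<in> E `` {a}" using S[of b] symF symE by blast
      qed
    qed (use that * VU in auto)
    \<comment> \<open>Neighbours in \<open>S'\<close>, \<open>Z'\<close> or equal to
      \<open>v\<close> are settled by symmetry; the others lie in the large clique of
      \<open>F\<close>.\<close>
    have R: "E `` {a} = F `` {a}" if "a \<in> U" "a \<notin> S'" "a \<notin> Z'" for a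
    proof (rule sub)
      show "E `` {a} \<subseteq> F `` {a}"
      proof
        fix b assume "b \<in> E `` {a}"
        then have ab: "(a, b) \<in> E" by simp
        consider "b \<in> S' \<union> Z' \<union> {v}" | "b \<in> U" "b \<notin> S'" "b \<notin> Z'" using EV[OF ab] VU by blast
        then show "b \<in> F `` {a}"
        proof cases
          case 1
          then have "E `` {b} = F `` {b}" using S Z v by blast
          then show ?thesis using symE[OF ab] symF by blast
        next
          case 2
          then show ?thesis using that EV[OF ab] by (auto simp: F)
        qed
      qed
    qed (use that VU in auto)
    have "E `` {a} = F `` {a}" for a
    proof (cases "a \<in> V")
      case True
      then show ?thesis using v S[of a] Z[of a] R[of a] VU by blast
    next
      case False
      then show ?thesis using assms(2) FV by auto
    qed
    then show "E = F" by (rule rel_eqI)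
  qed
  show ?thesis
    by (rule that[of d]) (fact cards quadF[unfolded F_def] rigid[unfolded F_def])+
qed


section \<open>The extremal graphs as coloured graphs\<close>

lemma complete_copies_simps:
  "pverts (complete_copies T m) = T \<times> {..<m}"
  "((s, i), (t, j)) \<in> parcs (complete_copies T m) \<longleftrightarrow>
    s \<in> T \<and> s = t \<and> i < m \<and> j < m \<and> i \<noteq> j"
  by (auto simp: complete_copies_def)

text \<open>\<open>2 \<le> l\<close> keeps the label of the added vertex apart from 0 and 1, and
  \<open>\<delta> \<le> \<kappa>\<close> ensures that its \<delta> neighbours exist in the join
  set.\<close>

lemma add_edges_join_coloured_graph:
  fixes l m \<kappa> \<delta> :: nat
  assumes "2 \<le> l" "\<delta> \<le> \<kappa>"
  shows "add_edges (graph_union (complete_graph l 1) (graph_join (complete_graph 0 \<kappa>)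
        (graph_union (complete_graph 1 m) (complete_copies {2..<l} 1))))
      {((l, 0), (0, i)) | i. i < \<delta>} =
    coloured_graph ({(l, 0)} \<union> {0} \<times> {..<\<kappa>} \<union> {1} \<times> {..<m} \<union> {2..<l} \<times> {..<1})
      (\<lambda>(t, i). if t = l then 4 else if t = 0 then if i < \<delta> then 3 else 0
        else if t = 1 then 1 else 2) pendant_rel"
    (is "?G = ?H")
proof (rule pair_pre_digraph.equality)
  have "((s, i), (t, j)) \<in> parcs ?G \<longleftrightarrow> ((s, i), (t, j)) \<in> parcs ?H" for s i t j
  proof -
    consider "s = l" | "s = 0" | "s = 1" | "s \<in> {2..<l}" | "s > l" by fastforce
    then show ?thesis
      using assms
      by cases (auto simp: add_edges_def graph_union_def graph_join_def
        complete_copies_simps coloured_graph_def pendant_rel_def)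
  qed
  then show "parcs ?G = parcs ?H" by (simp add: set_eq_iff)
qed (auto simp: add_edges_def graph_union_def graph_join_def complete_copies_simps coloured_graph_def)

lemma join_coloured_graph:
  "graph_join (complete_graph 0 \<kappa>) (graph_union (complete_graph 1 m) (complete_copies {2..l} p)) =
    coloured_graph ({0} \<times> {..<\<kappa>} \<union> {1} \<times> {..<m} \<union> {2..l} \<times> {..<p}) fst join_rel"
    (is "?G = ?H")
proof (rule pair_pre_digraph.equality)
  have "((s, i), (t, j)) \<in> parcs ?G \<longleftrightarrow> ((s, i), (t, j)) \<in> parcs ?H" for s i t j
  proof -
    consider "s = 0" | "s = 1" | "s \<ge> 2" by linarith
    then show ?thesis
      by cases (auto simp: graph_union_def graph_join_def
        complete_copies_simps coloured_graph_def join_rel_def)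
  qed
  then show "parcs ?G = parcs ?H" by (simp add: set_eq_iff)
qed (auto simp: graph_union_def graph_join_def complete_copies_simps coloured_graph_def)

section \<open>Degrees and cuts\<close>

lemma out_degree_with_proj: "out_degree (with_proj G) a = card (parcs G `` {a})"
proof -
  have "out_arcs (with_proj G) a = Pair a ` (parcs G `` {a})"
    by (auto simp: out_arcs_def)
  then show ?thesis by (simp add: out_degree_def card_image inj_on_def)
qed

lemma min_degree:
  assumes "finite (pverts G)" "pverts G \<noteq> {}"
  shows min_degree_le: "a \<in> pverts G \<Longrightarrow> min_degree G \<le> card (parcs G `` {a})"
    and min_degree_attained: "\<exists>v\<in>pverts G. card (parcs G `` {v}) = min_degree G"
proof -
  show "a \<in> pverts G \<Longrightarrow> min_degree G \<le> card (parcs G `` {a})"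
    using assms(1) by (simp add: min_degree_def out_degree_with_proj)
  have "min_degree G \<in> out_degree (with_proj G) ` pverts G"
    unfolding min_degree_def using assms by (intro Min_in) auto
  then show "\<exists>v\<in>pverts G. card (parcs G `` {v}) = min_degree G"
    by (auto simp: out_degree_with_proj)
qed

text \<open>A set attaining the minimum leaves at least \<open>l\<close> vertices by the bound on
  the order, so it must leave at least \<open>l\<close> components; \<open>c\<close> sends a vertex
  to its component.\<close>

lemma l_connectivity_cut:
  fixes G :: "'a pair_pre_digraph"
  assumes "pair_graph G" "l_connectivity l G + l \<le> card (pverts G)" "1 \<le> l"
  obtains S and c :: "'a \<Rightarrow> 'a set" where
    "S \<subseteq> pverts G" "card S = l_connectivity l G" "l \<le> card (c ` (pverts G - S))"
    "\<And>a b. (a, b) \<in> parcs G \<Longrightarrow> a \<in> pverts G - S \<Longrightarrow> b \<in> pverts G - S \<Longrightarrow> c a = c b"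
proof -
  interpret pair_graph G by fact
  let ?V = "pverts G"
  define H where "H S = induce_subgraph (with_proj G) (?V - S)" for S
  define P where "P k \<longleftrightarrow> (\<exists>S\<subseteq>?V. card S = k \<and>
    (\<not> Digraph_Component.connected (H S) \<and> num_components (H S) \<ge> l \<or> card (verts (H S)) < l))" for k
  \<comment> \<open>Removing all vertices leaves fewer than \<open>l\<close>, so the least value is
    attained.\<close>
  have "P (card ?V)"
    unfolding P_def using assms(3) by (intro exI[of _ ?V]) (auto simp: H_def)
  then have "P (Least P)" by (rule LeastI)
  moreover have "Least P = l_connectivity l G"
    by (simp add: l_connectivity_def P_def[abs_def] H_def Let_def)
  ultimately obtain S where S: "S \<subseteq> ?V" "card S = l_connectivity l G"
    and cut: "num_components (H S) \<ge> l \<or> card (verts (H S)) < l"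
    unfolding P_def by auto
  have "card (?V - S) = card ?V - card S"
    using S(1) pair_finite_verts by (simp add: card_Diff_subset finite_subset)
  then have "\<not> card (verts (H S)) < l"
    using S(2) assms(2) by (simp add: H_def)
  then have "num_components (H S) \<ge> l"
    using cut by blast
  interpret H: wf_digraph "H S"
    unfolding H_def by (rule wellformed_induce_subgraph)
  let ?c = "pre_digraph.scc_of (H S)"
  have "num_components (H S) = card (?c ` (?V - S))"
    using H.card_sccs_verts H.sccs_verts_conv_scc_of by (simp add: num_components_def H_def)
  moreover have "?c a = ?c b" if ab: "(a, b) \<in> parcs G" "a \<in> ?V - S" "b \<in> ?V - S" for a b
  proof -
    have "(b, a) \<in> parcs G" using ab(1) pair_sym_arcs by (auto simp: symmetric_def dest: symD)
    then have "(a, b) \<in> arcs_ends (H S)" "(b, a) \<in> arcs_ends (H S)"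
      using ab by (auto simp: H_def arcs_ends_conv image_iff)
    then have "a \<rightarrow>\<^sup>*\<^bsub>H S\<^esub> b" "b \<rightarrow>\<^sup>*\<^bsub>H S\<^esub> a" by (auto intro: H.reachable_adjI)
    then show ?thesis
      unfolding H.scc_of_def by (auto intro: H.reachable_trans)
  qed
  ultimately show ?thesis
    using that[OF S, of ?c] \<open>num_components (H S) \<ge> l\<close> by simp
qed

text \<open>The common end of both cases. \<open>H\<close> has the vertices of \<open>G\<close>, so
  the Perron vector can be tested on it; if the radii agree, it is an eigenvector of both graphs and
  all neighbour sums coincide, as \<open>rigid\<close> requires.\<close>

lemma extremal_by_comparison:
  fixes G H :: "'a pair_pre_digraph" and X :: "'b pair_pre_digraph"
  assumes "finite (pverts G)" "parcs G \<subseteq> pverts G \<times> pverts G" "\<exists>a\<in>pverts G. x a \<noteq> 0"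
    and perron: "quad_form x (parcs G) = graph_spectral_radius G * (\<Sum>a\<in>pverts G. (x a)\<^sup>2)"
      "\<And>a. a \<in> pverts G \<Longrightarrow> nbr_sum x (parcs G) a = graph_spectral_radius G * x a"
    and H: "pverts H = pverts G" "parcs H \<subseteq> pverts G \<times> pverts G" "sym (parcs H)"
    and le: "quad_form x (parcs G) \<le> quad_form x (parcs H)"
    and rigid: "(\<forall>a\<in>pverts G. nbr_sum x (parcs G) a = nbr_sum x (parcs H) a) \<longrightarrow>
      parcs G = parcs H"
    and iso: "digraph_iso (with_proj H) (with_proj X)"
  shows "graph_spectral_radius G \<le> graph_spectral_radius X \<and>
    (graph_spectral_radius G = graph_spectral_radius X \<longleftrightarrow> digraph_iso (with_proj G) (with_proj X))"
proof -
  have HX: "graph_spectral_radius H = graph_spectral_radius X"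
    using graph_spectral_radius_iso[OF iso] assms(1) H by simp
  have "graph_spectral_radius G * (\<Sum>a\<in>pverts H. (x a)\<^sup>2) \<le> quad_form x (parcs H)"
    using perron(1) le H(1) by simp
  note cmp = graph_spectral_radius_compare[OF _ _ H(3) _ this, unfolded H(1), OF assms(1) H(2) assms(3)]
  have "digraph_iso (with_proj G) (with_proj X)" if "graph_spectral_radius G = graph_spectral_radius X"
  proof -
    have "parcs G = parcs H"
      using cmp(2) that HX perron(2) by (intro rigid[rule_format]) simp
    then have "G = H" using H(1) by simp
    then show ?thesis using iso by simp
  qed
  moreover have "graph_spectral_radius G = graph_spectral_radius X"
    if "digraph_iso (with_proj G) (with_proj X)"
    using graph_spectral_radius_iso[OF that assms(1,2)] .
  ultimately show ?thesis using cmp(1) HX by auto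
qed

theorem theorem1p1:
  fixes G :: "'a pair_pre_digraph" and l n \<kappa> \<delta> :: nat
  assumes "l \<ge> 2"
    and "pair_graph G"
    and "Digraph_Component.connected (with_proj G)"
    and "card (pverts G) = n"
    and "\<delta> = min_degree G"
    and "\<kappa> = l_connectivity l G"
    and "n \<ge> \<kappa> + l"
  shows "graph_spectral_radius G \<le> graph_spectral_radius (extremal_graph l n \<kappa> \<delta>) \<and>
    (graph_spectral_radius G = graph_spectral_radius (extremal_graph l n \<kappa> \<delta>) \<longleftrightarrow>
     digraph_iso (with_proj G) (with_proj (extremal_graph l n \<kappa> \<delta>)))"
proof -
  interpret pair_graph G by fact
  let ?V = "pverts G" and ?E = "parcs G"
  have fV: "finite ?V" by (rule pair_finite_verts)
  have EV: "?E \<subseteq> ?V \<times> ?V" using arc_fst_in_verts arc_snd_in_verts by fastforce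
  have symE: "sym ?E" using pair_sym_arcs by (simp add: symmetric_def)
  have irrE: "irrefl ?E" using pair_no_loops by (fastforce simp: irrefl_def)
  have ne: "?V \<noteq> {}" using assms(1,4,7) by auto
  obtain x where xpos: "\<And>a. a \<in> ?V \<Longrightarrow> x a > 0" and x0: "\<And>a. x a \<ge> 0"
    and perron: "quad_form x ?E = graph_spectral_radius G * (\<Sum>a\<in>?V. (x a)\<^sup>2)"
      "\<And>a. a \<in> ?V \<Longrightarrow> nbr_sum x ?E a = graph_spectral_radius G * x a"
    by (rule perron_vector[OF assms(2,3)]) (rule that, assumption+)
  have xne: "\<exists>a\<in>?V. x a \<noteq> 0" using ne xpos by fastforce
  have "l_connectivity l G + l \<le> card ?V" "1 \<le> l" using assms by auto
  then obtain S and c :: "'a \<Rightarrow> 'a set" where S: "S \<subseteq> ?V" "card S = l_connectivity l G"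
    and cl: "l \<le> card (c ` (?V - S))"
    and cE: "\<And>a b. (a, b) \<in> ?E \<Longrightarrow> a \<in> ?V - S \<Longrightarrow> b \<in> ?V - S \<Longrightarrow> c a = c b"
    by (rule l_connectivity_cut[OF assms(2)]) (rule that, assumption+)
  note S = S[folded assms(6)]
  have fS: "finite S" using S(1) fV finite_subset by blast
  note finish = extremal_by_comparison[OF fV EV xne perron, where X = "extremal_graph l n \<kappa> \<delta>"]
  show ?thesis
  proof (cases "\<kappa> \<le> \<delta>")
    case True
    \<comment> \<open>A vertex has at least \<delta> neighbours, at most \<kappa> of them in
      \<open>S\<close>; the others and the vertex itself lie in its component.\<close>
    define p where "p = \<delta> - \<kappa> + 1"
    have size: "p \<le> card {a \<in> ?V - S. c a = t}" if t: "t \<in> c ` (?V - S)" for t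
    proof -
      obtain a where a: "a \<in> ?V - S" "c a = t" using t by auto
      let ?C = "{a \<in> ?V - S. c a = t}"
      have fC: "finite ?C" using fV by simp
      have "?E `` {a} \<subseteq> S \<union> (?C - {a})"
      proof
        fix b assume "b \<in> ?E `` {a}"
        then have "(a, b) \<in> ?E" "b \<in> ?V" "b \<noteq> a" using EV irrE by (auto simp: irrefl_def)
        then show "b \<in> S \<union> (?C - {a})" using cE[of a b] a by auto
      qed
      then have "card (?E `` {a}) \<le> card (S \<union> (?C - {a}))"
        using fS fC by (intro card_mono) auto
      also have "\<dots> \<le> card S + card (?C - {a})" by (rule card_Un_le)
      also have "card (?C - {a}) = card ?C - 1" using a fC by simp
      finally have "\<delta> \<le> \<kappa> + (card ?C - 1)"
        using min_degree_le[OF fV ne, of a] a S(2) assms(5) by simp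
      moreover have "card ?C > 0" using a fC by (auto simp: card_gt_0_iff)
      ultimately show ?thesis by (simp add: p_def)
    qed
    have "1 \<le> l" using assms(1) by simp
    obtain d :: "'a \<Rightarrow> nat" where cards: "\<And>t. card {a \<in> ?V. d a = t} =
        (if t = 0 then card S else if t = 1 then card ?V - card S - (l - 1) * p
         else if t \<le> l then p else 0)"
      and quad: "quad_form x ?E \<le> quad_form x (parcs (coloured_graph ?V d join_rel))"
      and rigid: "(\<forall>a\<in>?V.
          nbr_sum x ?E a = nbr_sum x (parcs (coloured_graph ?V d join_rel)) a) \<longrightarrow>
        ?E = parcs (coloured_graph ?V d join_rel)"
      by (rule join_comparison[OF fV EV irrE symE S(1) cE \<open>1 \<le> l\<close> cl, of p x])
        (assumption, assumption, assumption, rule size, assumption, rule x0, rule xpos, assumption,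
          rule that, assumption+)
    let ?X = "{0} \<times> {..<\<kappa>} \<union> {1} \<times> {..<n - \<kappa> - (l - 1) * p} \<union> {2..l} \<times> {..<p}"
    have X: "extremal_graph l n \<kappa> \<delta> = coloured_graph ?X fst join_rel"
      unfolding join_coloured_graph[symmetric] using True by (simp add: extremal_graph_def p_def)
    have "card {a \<in> ?X. fst a = t} =
        (if t = 0 then \<kappa> else if t = 1 then n - \<kappa> - (l - 1) * p else if t \<le> l then p else 0)" for t
    proof -
      have "{a \<in> ?X. fst a = t} = {t} \<times> (if t = 0 then {..<\<kappa>}
          else if t = 1 then {..<n - \<kappa> - (l - 1) * p} else if t \<le> l then {..<p} else {})"
        by auto
      then show ?thesis by (simp add: card_cartesian_product)
    qed
    then have "digraph_iso (with_proj (coloured_graph ?V d join_rel))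
        (with_proj (extremal_graph l n \<kappa> \<delta>))"
      unfolding X using fV cards S(2) assms(4) by (intro coloured_graph_iso) auto
    moreover have "pverts (coloured_graph ?V d join_rel) = ?V" "parcs (coloured_graph ?V d join_rel) \<subseteq> ?V \<times> ?V"
      "sym (parcs (coloured_graph ?V d join_rel))"
      by (auto simp: parcs_coloured_graph join_rel_def sym_def)
    ultimately show ?thesis by (intro finish[OF _ _ _ _ quad rigid])
  next
    case False
    obtain v where v: "v \<in> ?V" "card (?E `` {v}) = \<delta>"
      using min_degree_attained[OF fV ne] assms(5) by blast
    have "?V - S \<noteq> {}" using cl assms(1) by (metis card.empty image_empty le_zero_eq not_numeral_le_zero)
    \<comment> \<open>Giving up \<open>y\<close> costs at most one component and leaves exactly
      \<kappa> vertices besides \<open>v\<close> outside \<open>W\<close>: the set \<open>S\<close>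
      if \<open>y = v\<close>, and otherwise \<open>S\<close> with \<open>v\<close> replaced by
      \<open>y\<close>.\<close>
    then obtain y where y: "y \<in> ?V - S" "v \<notin> S \<Longrightarrow> y = v" using v(1) by blast
    define W where "W = ?V - S - {y}"
    have W: "W \<subseteq> ?V - {v}" using y(2) by (auto simp: W_def)
    have cEW: "c a = c b" if "(a, b) \<in> ?E" "a \<in> W" "b \<in> W" for a b
      using cE that by (auto simp: W_def)
    have "c ` (?V - S) \<subseteq> insert (c y) (c ` W)" by (auto simp: W_def)
    then have "card (c ` (?V - S)) \<le> card (insert (c y) (c ` W))"
      using fV by (intro card_mono) (auto simp: W_def)
    also have "\<dots> \<le> Suc (card (c ` W))" by (rule card_insert_le_m1) auto
    finally have m: "l - 1 \<le> card (c ` W)" using cl by simp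
    have m1: "1 \<le> l - 1" using assms(1) by simp
    have "card W = n - \<kappa> - 1"
      using y(1) fV fS S assms(4) by (simp add: W_def card_Diff_subset)
    then have \<kappa>: "card (?V - {v} - W) = \<kappa>"
      using W v(1) fV assms(1,4,7) finite_subset[OF W] by (simp add: card_Diff_subset)
    have "\<delta> \<le> \<kappa>" using False by simp
    \<comment> \<open>The \<open>l - 1\<close> remaining classes become one large clique and
      \<open>l - 2\<close> single vertices.\<close>
    obtain d :: "'a \<Rightarrow> nat" where cards: "\<And>t. card {a \<in> ?V. d a = t} =
        (if t = 0 then \<kappa> - \<delta> else if t = 1 then card ?V - \<kappa> - (l - 1) else if t = 2 then l - 1 - 1
         else if t = 3 then \<delta> else if t = 4 then 1 else 0)"
      and quad: "quad_form x ?E \<le> quad_form x (parcs (coloured_graph ?V d pendant_rel))"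
      and rigid: "(\<forall>a\<in>?V.
          nbr_sum x ?E a = nbr_sum x (parcs (coloured_graph ?V d pendant_rel)) a) \<longrightarrow>
        ?E = parcs (coloured_graph ?V d pendant_rel)"
      by (rule pendant_comparison[OF fV EV irrE symE v(1) W cEW m1 m v(2) \<kappa> \<open>\<delta> \<le> \<kappa>\<close>, of x])
        (assumption, assumption, assumption, rule x0, rule xpos, assumption, rule that, assumption+)
    let ?X = "{(l, 0)} \<union> {0} \<times> {..<\<kappa>} \<union> {1} \<times> {..<n - \<kappa> - l + 1} \<union> {2..<l} \<times> {..<1 :: nat}"
    let ?c = "\<lambda>(t, i). if t = l then 4 else if t = 0 then if i < \<delta> then 3 else 0
      else if t = 1 then 1 else 2 :: nat"
    have X: "extremal_graph l n \<kappa> \<delta> = coloured_graph ?X ?c pendant_rel"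
      using False add_edges_join_coloured_graph[OF assms(1) \<open>\<delta> \<le> \<kappa>\<close>]
      by (simp only: extremal_graph_def) simp
    have "card {a \<in> ?X. ?c a = t} = 
        (if t = 0 then \<kappa> - \<delta> else if t = 1 then n - \<kappa> - (l - 1) else if t = 2 then l - 1 - 1
         else if t = 3 then \<delta> else if t = 4 then 1 else 0)" for t
    proof -
      have "{a \<in> ?X. ?c a = t} = (if t = 0 then {0} \<times> {\<delta>..<\<kappa>}
        else if t = 1 then {1} \<times> {..<n - \<kappa> - l + 1} else if t = 2 then {2..<l} \<times> {..<1}
        else if t = 3 then {0} \<times> {..<\<delta>} else if t = 4 then {(l, 0)} else {})"
        using assms(1) False by (auto split: if_splits)
      \<comment> \<open>By \<open>n \<ge> \<kappa> + l\<close> the truncated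
        \<open>n - \<kappa> - l + 1\<close> equals \<open>n - \<kappa> - (l - 1)\<close>.\<close>
      then show ?thesis using assms(1,7) by (simp add: card_cartesian_product numeral_2_eq_2 Suc_diff_le)
    qed
    then have "digraph_iso (with_proj (coloured_graph ?V d pendant_rel))
        (with_proj (extremal_graph l n \<kappa> \<delta>))"
      unfolding X using fV cards assms(4) by (intro coloured_graph_iso) auto
    moreover have "pverts (coloured_graph ?V d pendant_rel) = ?V" "parcs (coloured_graph ?V d pendant_rel) \<subseteq> ?V \<times> ?V"
      "sym (parcs (coloured_graph ?V d pendant_rel))"
      by (auto simp: parcs_coloured_graph pendant_rel_def sym_def)
    ultimately show ?thesis by (intro finish[OF _ _ _ _ quad rigid])
  qed
qed

end
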